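(* Let $m=2$ and $n\ge3$. For every non-negative integer $i$, the term $N_i$ of the normalizer chain in $\Sigma$ is the saturated subgroup generated by the saturated set of rigid commutators $f(\mathcal{N}_i)$. In particular, for each $i\ge1$, $$\mathrm{rk}\left(\mathfrak{N}_i/\mathfrak{N}_{i-1}\right)=\log_2|N_i:N_{i-1}|.$$
   Context: Lie ring side (with $m=2$). A partition is a finitely supported sequence $\Lambda=(\lambda_i)_{i\ge1}$ of non-negative integers; $\mathrm{supp}(\Lambda)=\{i\mid\lambda_i\ne0\}$. For $j\ge 0$, $\mathcal{P}_2(j)$ is the set of partitions with all parts at most $j$ (i.e. $\lambda_i=0$ for $i>j$) and all $\lambda_i\le1$. Write $x^\Lambda=\prod_i x_i^{\lambda_i}$, regarded in $\mathcal{O}_2(n)=\mathbb{Z}_2[x_1,\dots,x_n]/(x_1^2,\dots,x_n^2)$, on which the partial derivatives $\partial_k$ act as derivations. $\mathfrak{L}=\mathfrak{L}(n)$ is the free $\mathbb{Z}_2$-module with basis $\mathcal{B}=\{x^\Lambda\partial_k\mid 1\le k\le n,\ \Lambda\in\mathcal{P}_2(k-1)\}$ and Lie bracket determined bilinearly by $[x^\Lambda\partial_k,x^\Theta\partial_j]=\partial_j(x^\Lambda)x^\Theta\partial_k-x^\Lambda\partial_k(x^\Theta)\partial_j$. For $\mathcal{H}\subseteq\mathcal{B}$, $N_{\mathcal{B}}(\mathcal{H})=\{b\in\mathcal{B}\mid [b,h]\in\mathcal{H}\cup\{0\}\ \forall h\in\mathcal{H}\}$. Put $\mathcal{T}=\{\partial_1,\dots,\partial_n\}$,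 $\mathcal{N}_0=N_{\mathcal{B}}(\mathcal{T})$ and $\mathcal{N}_i=N_{\mathcal{B}}(\mathcal{N}_{i-1})$ for $i\ge1$. The idealizer of a subring $\mathfrak{H}$ of $\mathfrak{L}$ is $N_{\mathfrak{L}}(\mathfrak{H})=\{z\in\mathfrak{L}\mid [z,h]\in\mathfrak{H}\ \forall h\in\mathfrak{H}\}$; with $\mathfrak{T}$ the $\mathbb{Z}_2$-span of $\mathcal{T}$, the idealizer chain is $\mathfrak{N}_0=N_{\mathfrak{L}}(\mathfrak{T})$, $\mathfrak{N}_i=N_{\mathfrak{L}}(\mathfrak{N}_{i-1})$ for $i\ge1$. $\mathrm{rk}$ denotes the rank as a (free) $\mathbb{Z}_2$-module. Group side. Identify the $2^n$ letters with $\mathbb{F}_2^n$. For $1\le i\le n$ let $s_i$ be the permutation of $\mathbb{F}_2^n$ that changes the $i$-th coordinate $w_i$ to $w_i+1$ when $w_1=\dots=w_{i-1}=0$, and fixes $w$ otherwise. Then $\Sigma=\langle s_1,\dots,s_n\rangle$ is a Sylow $2$-subgroup of $\mathrm{Sym}(2^n)$. For $X=\{x_1>x_2>\dots>x_\ell\}\subseteq\{1,\dots,n\}$ let $[X]$ be the left-normed commutator $[s_{x_1},s_{x_2},\dots,s_{x_\ell}]$, with $[\emptyset]=1$. For $1\le b\le n$ and $I\subseteq\{1,\dots,b-1\}$, the rigid commutator based at $b$ and punctured at $I$ is $\vee[b;I]=[\{1,\dots,b\}\setminus I]$. Let $\mathcal{R}^*$ be the set of all $\vee[b;I]$ (the non-trivial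 rigid commutators) and $\mathcal{R}=\mathcal{R}^*\cup\{[\emptyset]\}$. Set $t_i=\vee[i;\emptyset]$ and $T=\langle t_1,\dots,t_n\rangle$, an elementary abelian regular subgroup of $\Sigma$. The normalizer chain is $N_0=N_\Sigma(T)$, $N_i=N_\Sigma(N_{i-1})$ for $i\ge1$. A set of rigid commutators is saturated if, together with the identity, it is closed under taking commutators; a subgroup of $\Sigma$ is saturated if it is generated by a saturated set of rigid commutators. The map $f\colon\mathcal{B}\cup\{0\}\to\mathcal{R}$ is the bijection given by $f(0)=[\emptyset]$ and $f(x^\Lambda\partial_k)=\vee[k;\mathrm{supp}(\Lambda)]$. *)

theory Defs
  imports
    Complex_Main
    "HOL-Algebra.Algebra"
    "HOL-Library.Poly_Mapping"
    "HOL-Library.Set_Algebras"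
    "HOL-Library.Z2"
begin

section \<open>The Lie ring\<close>

text \<open>
  A partition is a finitely supported sequence indexed by the positive integers;
  the entry at index 0 is required to vanish.
\<close>

type_synonym partition = "nat \<Rightarrow>\<^sub>0 nat"

definition supp :: "partition \<Rightarrow> nat set" where
  "supp \<Lambda> = {i. Poly_Mapping.lookup \<Lambda> i \<noteq> 0}"

definition partitions2 :: "nat \<Rightarrow> partition set" where
  "partitions2 j =
     {\<Lambda>. supp \<Lambda> \<subseteq> {1..j} \<and> (\<forall>i. Poly_Mapping.lookup \<Lambda> i \<le> 1)}"

text \<open>
  An element of the quotient of the polynomial ring over the field with two elements by the
  squares of the variables is represented by the unique polynomial in its residue class all of
  whose monomials are square-free. The function \<open>reduce\<close> selects this representative, see
  \<open>reduce_eq_0_iff\<close> below.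
\<close>

type_synonym poly2 = "partition \<Rightarrow>\<^sub>0 bit"

definition monomial :: "partition \<Rightarrow> poly2" where
  "monomial \<Lambda> = Poly_Mapping.single \<Lambda> 1"

definition reduce :: "poly2 \<Rightarrow> poly2" where
  "reduce p = (\<Sum>\<Lambda> \<in> {\<Lambda> \<in> Poly_Mapping.keys p. \<forall>i. Poly_Mapping.lookup \<Lambda> i \<le> 1}.
     Poly_Mapping.single \<Lambda> (Poly_Mapping.lookup p \<Lambda>))"

definition times_trunc :: "poly2 \<Rightarrow> poly2 \<Rightarrow> poly2" where
  "times_trunc p q = reduce (p * q)"

definition pderivative :: "nat \<Rightarrow> poly2 \<Rightarrow> poly2" where
  "pderivative k p = (\<Sum>\<Lambda> \<in> Poly_Mapping.keys p.
     Poly_Mapping.single (\<Lambda> - Poly_Mapping.single k 1)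
       (of_nat (Poly_Mapping.lookup \<Lambda> k) * Poly_Mapping.lookup p \<Lambda>))"

text \<open>
  The index \<open>(\<Lambda>, k)\<close> stands for the basis element \<open>x\<^sup>\<Lambda> \<partial>\<^sub>k\<close>.
\<close>

type_synonym lie = "(partition \<times> nat) \<Rightarrow>\<^sub>0 bit"

definition lie_scale :: "bit \<Rightarrow> lie \<Rightarrow> lie" where
  "lie_scale c z = Poly_Mapping.map (\<lambda>a. c * a) z"

definition basis_index :: "nat \<Rightarrow> (partition \<times> nat) set" where
  "basis_index n = {(\<Lambda>, k). 1 \<le> k \<and> k \<le> n \<and> \<Lambda> \<in> partitions2 (k - 1)}"

definition basis_elem :: "partition \<Rightarrow> nat \<Rightarrow> lie" where
  "basis_elem \<Lambda> k = Poly_Mapping.single (\<Lambda>, k) 1"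

definition lie_basis :: "nat \<Rightarrow> lie set" where
  "lie_basis n = {basis_elem \<Lambda> k |\<Lambda> k. (\<Lambda>, k) \<in> basis_index n}"

definition lie_carrier :: "nat \<Rightarrow> lie set" where
  "lie_carrier n = {z. Poly_Mapping.keys z \<subseteq> basis_index n}"

text \<open>
  For a polynomial \<open>p\<close> with square-free monomials, \<open>times_del p k\<close> is \<open>p \<partial>\<^sub>k\<close>.
\<close>

definition times_del :: "poly2 \<Rightarrow> nat \<Rightarrow> lie" where
  "times_del p k = (\<Sum>\<Lambda> \<in> Poly_Mapping.keys p.
     Poly_Mapping.single (\<Lambda>, k) (Poly_Mapping.lookup p \<Lambda>))"

fun basis_bracket :: "partition \<times> nat \<Rightarrow> partition \<times> nat \<Rightarrow> lie" where
  "basis_bracket (\<Lambda>, k) (\<Theta>, j) =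
     times_del (times_trunc (pderivative j (monomial \<Lambda>)) (monomial \<Theta>)) k
     - times_del (times_trunc (monomial \<Lambda>) (pderivative k (monomial \<Theta>))) j"

definition bracket :: "lie \<Rightarrow> lie \<Rightarrow> lie" where
  "bracket u v = (\<Sum>a \<in> Poly_Mapping.keys u. \<Sum>b \<in> Poly_Mapping.keys v.
     lie_scale (Poly_Mapping.lookup u a * Poly_Mapping.lookup v b) (basis_bracket a b))"

definition basis_idealizer :: "nat \<Rightarrow> lie set \<Rightarrow> lie set" where
  "basis_idealizer n H = {b \<in> lie_basis n. \<forall>h \<in> H. bracket b h \<in> H \<union> {0}}"

definition del_set :: "nat \<Rightarrow> lie set" where
  "del_set n = {basis_elem 0 k |k. 1 \<le> k \<and> k \<le> n}"

primrec basis_chain :: "nat \<Rightarrow> nat \<Rightarrow> lie set" where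
  "basis_chain n 0 = basis_idealizer n (del_set n)"
| "basis_chain n (Suc i) = basis_idealizer n (basis_chain n i)"

definition idealizer :: "nat \<Rightarrow> lie set \<Rightarrow> lie set" where
  "idealizer n H = {z \<in> lie_carrier n. \<forall>h \<in> H. bracket z h \<in> H}"

primrec idealizer_chain :: "nat \<Rightarrow> nat \<Rightarrow> lie set" where
  "idealizer_chain n 0 = idealizer n (Modules.module.span lie_scale (del_set n))"
| "idealizer_chain n (Suc i) = idealizer n (idealizer_chain n i)"

text \<open>
  The quotient \<open>A / B\<close> as a module over the field with two elements, whose elements are the
  cosets \<open>a + B\<close>. The record fields for a multiplication and a unit play no role in a module.
\<close>

definition quotient_module :: "lie set \<Rightarrow> lie set \<Rightarrow> (bit, lie set) module" where
  "quotient_module A B =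
     \<lparr>carrier = (\<lambda>a. a +o B) ` A, monoid.mult = undefined, monoid.one = undefined,
      ring.zero = B, ring.add = (\<lambda>U V. U + V), smult = (\<lambda>c U. lie_scale c ` U + B)\<rparr>"

definition is_module_basis :: "('c, 'v) module \<Rightarrow> 'v set \<Rightarrow> bool" where
  "is_module_basis M S \<longleftrightarrow> finite S \<and> S \<subseteq> carrier M \<and>
     (\<forall>v \<in> carrier M. \<exists>!c. c \<in> S \<rightarrow>\<^sub>E UNIV \<and> v = (\<Oplus>\<^bsub>M\<^esub>s \<in> S. c s \<odot>\<^bsub>M\<^esub> s))"

definition module_rank :: "('c, 'v) module \<Rightarrow> nat" where
  "module_rank M = (THE r. \<exists>S. is_module_basis M S \<and> card S = r)"


section \<open>The Sylow 2-subgroup\<close>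

text \<open>
  A letter is a vector with coordinates \<open>w\<^sub>1, \<dots>, w\<^sub>n\<close> over the field with two elements,
  encoded as an extensional function on \<open>{1..n}\<close>.
\<close>

definition letters :: "nat \<Rightarrow> (nat \<Rightarrow> bit) set" where
  "letters n = {1..n} \<rightarrow>\<^sub>E UNIV"

type_synonym perm2 = "(nat \<Rightarrow> bit) \<Rightarrow> (nat \<Rightarrow> bit)"

definition sgen :: "nat \<Rightarrow> nat \<Rightarrow> perm2" where
  "sgen n i = (\<lambda>w \<in> letters n. if \<forall>j \<in> {1..<i}. w j = 0 then w(i := w i + 1) else w)"

definition Sylow2 :: "nat \<Rightarrow> perm2 monoid" where
  "Sylow2 n = BijGroup (letters n)
     \<lparr>carrier := generate (BijGroup (letters n)) (sgen n ` {1..n})\<rparr>"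

definition commutator :: "('a, 'b) monoid_scheme \<Rightarrow> 'a \<Rightarrow> 'a \<Rightarrow> 'a" where
  "commutator G a b = inv\<^bsub>G\<^esub> a \<otimes>\<^bsub>G\<^esub> inv\<^bsub>G\<^esub> b \<otimes>\<^bsub>G\<^esub> a \<otimes>\<^bsub>G\<^esub> b"

fun left_normed :: "('a, 'b) monoid_scheme \<Rightarrow> 'a list \<Rightarrow> 'a" where
  "left_normed G [] = \<one>\<^bsub>G\<^esub>"
| "left_normed G (x # xs) = foldl (commutator G) x xs"

definition set_commutator :: "nat \<Rightarrow> nat set \<Rightarrow> perm2" where
  "set_commutator n A =
     left_normed (Sylow2 n) (map (sgen n) (rev (sorted_list_of_set A)))"

definition rigid :: "nat \<Rightarrow> nat \<Rightarrow> nat set \<Rightarrow> perm2" where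
  "rigid n b I = set_commutator n ({1..b} - I)"

definition rigid_commutators :: "nat \<Rightarrow> perm2 set" where
  "rigid_commutators n =
     {rigid n b I |b I. 1 \<le> b \<and> b \<le> n \<and> I \<subseteq> {1..b - 1}} \<union> {set_commutator n {}}"

definition transl_group :: "nat \<Rightarrow> perm2 set" where
  "transl_group n = generate (Sylow2 n) ((\<lambda>i. rigid n i {}) ` {1..n})"

primrec normalizer_chain :: "nat \<Rightarrow> nat \<Rightarrow> perm2 set" where
  "normalizer_chain n 0 = normalizer (Sylow2 n) (transl_group n)"
| "normalizer_chain n (Suc i) = normalizer (Sylow2 n) (normalizer_chain n i)"

definition group_index :: "('a, 'b) monoid_scheme \<Rightarrow> 'a set \<Rightarrow> 'a set \<Rightarrow> nat" where
  "group_index G K H = card (rcosets\<^bsub>G\<lparr>carrier := K\<rparr>\<^esub> H)"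

definition saturated :: "nat \<Rightarrow> perm2 set \<Rightarrow> bool" where
  "saturated n S \<longleftrightarrow> S \<subseteq> rigid_commutators n \<and>
     (\<forall>a \<in> S \<union> {\<one>\<^bsub>Sylow2 n\<^esub>}. \<forall>b \<in> S \<union> {\<one>\<^bsub>Sylow2 n\<^esub>}.
        commutator (Sylow2 n) a b \<in> S \<union> {\<one>\<^bsub>Sylow2 n\<^esub>})"

definition saturated_subgroup :: "nat \<Rightarrow> perm2 set \<Rightarrow> bool" where
  "saturated_subgroup n H \<longleftrightarrow> subgroup H (Sylow2 n) \<and>
     (\<exists>S. saturated n S \<and> H = generate (Sylow2 n) S)"

text \<open>
  A basis element is a single term with coefficient 1, so its set of keys is the singleton of its
  index. See \<open>to_rigid_0\<close> and \<open>to_rigid_basis_elem\<close> below; other arguments are irrelevant.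
\<close>

definition to_rigid :: "nat \<Rightarrow> lie \<Rightarrow> perm2" where
  "to_rigid n z =
     (if z = 0 then set_commutator n {}
      else case the_elem (Poly_Mapping.keys z) of (\<Lambda>, k) \<Rightarrow> rigid n k (supp \<Lambda>))"


section \<open>Sanity checks\<close>

lemma to_rigid_0: "to_rigid n 0 = set_commutator n {}"
  by (simp add: to_rigid_def)

lemma to_rigid_basis_elem: "to_rigid n (basis_elem \<Lambda> k) = rigid n k (supp \<Lambda>)"
proof -
  have "basis_elem \<Lambda> k \<noteq> 0"
    by (metis basis_elem_def lookup_single_eq lookup_zero zero_neq_one)
  then show ?thesis
    by (simp add: to_rigid_def basis_elem_def)
qed

lemma lookup_lie_scale: "Poly_Mapping.lookup (lie_scale c z) a = c * Poly_Mapping.lookup z a"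
  by (simp add: lie_scale_def Poly_Mapping.map.rep_eq when_def)

lemma vector_space_lie_scale: "vector_space lie_scale"
  by unfold_locales
    (auto intro!: poly_mapping_eqI simp: lookup_lie_scale lookup_add algebra_simps)

lemma lookup_reduce:
  "Poly_Mapping.lookup (reduce p) \<Lambda> =
     (if \<forall>i. Poly_Mapping.lookup \<Lambda> i \<le> 1 then Poly_Mapping.lookup p \<Lambda> else 0)"
proof -
  let ?K = "{\<Lambda> \<in> Poly_Mapping.keys p. \<forall>i. Poly_Mapping.lookup \<Lambda> i \<le> 1}"
  have "Poly_Mapping.lookup (reduce p) \<Lambda> =
      (\<Sum>\<Theta> \<in> ?K. if \<Theta> = \<Lambda> then Poly_Mapping.lookup p \<Theta> else 0)"
    unfolding reduce_def lookup_sum lookup_single when_def ..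
  also have "\<dots> = (if \<Lambda> \<in> ?K then Poly_Mapping.lookup p \<Lambda> else 0)"
    by (subst sum.delta) simp_all
  finally show ?thesis
    by (simp only: mem_Collect_eq in_keys_iff) metis
qed

text \<open>
  Two polynomials are congruent modulo the ideal generated by the squares of the variables if and
  only if \<open>reduce\<close> maps their difference to 0.
\<close>

lemma reduce_eq_0_iff:
  "reduce p = 0 \<longleftrightarrow>
     p \<in> Modules.module.span (*) {Poly_Mapping.single (Poly_Mapping.single i 2) 1 |i. True}"
  (is "_ \<longleftrightarrow> p \<in> ?I")
proof -
  interpret M: Modules.module "(*) :: poly2 \<Rightarrow> poly2 \<Rightarrow> poly2"
    by unfold_locales (auto simp: algebra_simps)
  let ?x = "\<lambda>i. Poly_Mapping.single (Poly_Mapping.single i 2) 1 :: poly2"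
  show ?thesis
  proof
    assume r: "reduce p = 0"
    have trm: "Poly_Mapping.single \<Lambda> (Poly_Mapping.lookup p \<Lambda>) \<in> ?I"
      if k: "\<Lambda> \<in> Poly_Mapping.keys p" for \<Lambda>
    proof -
      have "\<not> (\<forall>i. Poly_Mapping.lookup \<Lambda> i \<le> 1)"
        using r k lookup_reduce[of p \<Lambda>] by (metis in_keys_iff lookup_zero)
      then obtain i where i: "Poly_Mapping.lookup \<Lambda> i \<ge> 2"
        by (metis Suc_1 not_less_eq_eq One_nat_def)
      have "\<Lambda> = (\<Lambda> - Poly_Mapping.single i 2) + Poly_Mapping.single i 2"
        using i by (intro poly_mapping_eqI) (auto simp: lookup_add lookup_minus lookup_single when_def)
      then have "Poly_Mapping.single \<Lambda> (Poly_Mapping.lookup p \<Lambda>)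
          = Poly_Mapping.single (\<Lambda> - Poly_Mapping.single i 2) (Poly_Mapping.lookup p \<Lambda>) * ?x i"
        by (metis mult.right_neutral mult_single)
      moreover have "?x i \<in> ?I" by (rule M.span_base) blast
      ultimately show ?thesis
        by (metis M.span_scale)
    qed
    have "p = (\<Sum>\<Lambda> \<in> Poly_Mapping.keys p. Poly_Mapping.single \<Lambda> (Poly_Mapping.lookup p \<Lambda>))"
      by (intro poly_mapping_eqI)
        (auto simp: lookup_sum lookup_single when_def in_keys_iff sum.delta)
    then show "p \<in> ?I"
      using trm by (metis (no_types, lifting) M.span_sum)
  next
    assume "p \<in> ?I"
    then show "reduce p = 0"
    proof (induction rule: M.span_induct_alt)
      case base
      show ?case by (intro poly_mapping_eqI) (simp add: lookup_reduce)
    next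
      case (step q x p)
      then obtain i where x: "x = ?x i" by auto
      have "Poly_Mapping.lookup (q * x) \<Lambda> = 0" if "\<forall>j. Poly_Mapping.lookup \<Lambda> j \<le> 1" for \<Lambda>
      proof (rule ccontr)
        assume "Poly_Mapping.lookup (q * x) \<Lambda> \<noteq> 0"
        then have "\<Lambda> \<in> Poly_Mapping.keys (q * x)" by (simp add: in_keys_iff)
        then obtain a where "\<Lambda> = a + Poly_Mapping.single i 2"
          using keys_mult[of q x] x by (auto split: if_splits)
        then have "Poly_Mapping.lookup \<Lambda> i \<ge> 2" by (simp add: lookup_add)
        then show False using that by (metis not_less_eq_eq numeral_2_eq_2 One_nat_def)
      qed
      moreover have "Poly_Mapping.lookup p \<Lambda> = 0" if "\<forall>j. Poly_Mapping.lookup \<Lambda> j \<le> 1" for \<Lambda>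
        using step.IH that lookup_reduce[of p \<Lambda>] by simp
      ultimately show ?case
        by (intro poly_mapping_eqI) (simp add: lookup_reduce lookup_add)
    qed
  qed
qed

end

theory Submission
  imports Defs
begin

text \<open>
  In the coordinates \<open>y\<^sub>i = w\<^sub>i + 1\<close> the rigid commutator based at \<open>k\<close>
  and punctured at \<open>I\<close> is the transvection adding the product of the \<open>y\<^sub>i\<close>
  with \<open>i \<in> I\<close> to \<open>y\<^sub>k\<close>. Let \<open>V\<^sub>k\<close> be spanned by the
  square-free monomials with index sets in \<open>H k\<close>. If \<open>H\<close> is closed under
  substituting the monomials of \<open>H j\<close> for \<open>y\<^sub>j\<close>, then the saturated subgroup
  of \<open>H\<close> consists of all maps \<open>y\<^sub>k \<mapsto> y\<^sub>k + p\<^sub>k\<close> with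
  \<open>p\<^sub>k \<in> V\<^sub>k\<close>. A map \<open>g\<close> of this shape normalizes it if and only if
  \<open>V\<^sub>k \<circ> g = V\<^sub>k\<close> and \<open>p\<^sub>k \<circ> h + p\<^sub>k \<in>
  V\<^sub>k\<close> for all \<open>h\<close> in the subgroup. The second condition is linear in
  \<open>p\<^sub>k\<close>. Extracting the part of top degree in one variable at a time, the first condition
  passes from \<open>g\<close> to its truncations and hence to its factors, which are transvections. As the
  \<open>V\<^sub>k\<close> contain the divisors of their monomials, both conditions can then be tested
  monomial by monomial, so the normalizer is again saturated. On monomials the commutator and the Lie bracket
  differ only when a square \<open>x\<^sub>i\<^sup>2\<close> occurs, and cancelling the common variables
  beforehand shows that the two normalizing conditions agree. The bracket with a fixed basis element maps
  distinct basis elements to distinct ones or to 0, so idealizers are spanned by basis elements as well; ranks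
  and indices are then counted on bases.
\<close>

section \<open>Square-free polynomial functions\<close>

text \<open>These rules would rewrite the field operations to bitwise XOR and AND.\<close>

declare add_bit_eq_xor [simp del] mult_bit_eq_and [simp del]

section \<open>Arithmetic in the field with two elements\<close>

lemma bit_add_self [simp]: "a + a = (0::bit)"
  by (cases a) simp_all

lemma bit_add_left_cancel2 [simp]: "a + (a + b) = (b::bit)"
  by (simp flip: add.assoc)

lemma bit_add_cancel_middle: "a + b = a + c + (b + (c::bit))"
  by (cases a; cases b; cases c) simp_all

lemma bit_add_eq_iff: "a + b = c \<longleftrightarrow> a = b + (c::bit)"
  by (metis add.commute bit_add_left_cancel2)

text \<open>The factor \<open>w i + 1\<close> is the shifted coordinate \<open>y\<^sub>i\<close>,
  which makes the monomial of a finite \<open>I\<close> the indicator of the points whose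
  coordinates in \<open>I\<close> all vanish.\<close>

definition sqmon :: "nat set \<Rightarrow> (nat \<Rightarrow> bit) \<Rightarrow> bit" where
  "sqmon I w = (\<Prod>i\<in>I. w i + 1)"

definition pol :: "nat set set \<Rightarrow> (nat \<Rightarrow> bit) \<Rightarrow> bit" where
  "pol S w = (\<Sum>I\<in>S. sqmon I w)"

text \<open>Only values on \<open>letters n\<close> count, so maps can be composed here without
  first restricting them to the letters.\<close>

definition spanned :: "nat \<Rightarrow> nat set set \<Rightarrow> ((nat \<Rightarrow> bit) \<Rightarrow> bit) set" where
  "spanned n C = {p. \<exists>S\<subseteq>C. \<forall>w\<in>letters n. p w = pol S w}"

lemma letters_update:
  assumes "w \<in> letters n" "j \<in> {1..n}"
  shows "w(j := c) \<in> letters n"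
proof -
  have "w(j := c) \<in> insert j {1..n} \<rightarrow>\<^sub>E UNIV"
    using assms(1) unfolding letters_def by (intro PiE_fun_upd UNIV_I)
  then show ?thesis unfolding letters_def insert_absorb[OF assms(2)] .
qed

lemma sqmon_empty [simp]: "sqmon {} w = 1"
  by (simp add: sqmon_def)

lemma sqmon_eq: "finite I \<Longrightarrow> sqmon I w = (if \<forall>i\<in>I. w i = 0 then 1 else 0)"
  by (induction I rule: finite_induct) (auto simp: sqmon_def)

lemma sqmon_mult: "finite I \<Longrightarrow> finite J \<Longrightarrow> sqmon I w * sqmon J w = sqmon (I \<union> J) w"
  by (auto simp: sqmon_eq)

lemma sqmon_remove: "finite I \<Longrightarrow> i \<in> I \<Longrightarrow> sqmon I w = (w i + 1) * sqmon (I - {i}) w"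
  by (simp add: sqmon_def prod.remove)

lemma sqmon_cong: "(\<And>i. i \<in> I \<Longrightarrow> w i = v i) \<Longrightarrow> sqmon I w = sqmon I v"
  by (simp add: sqmon_def)

lemma pol_empty [simp]: "pol {} w = 0"
  by (simp add: pol_def)

lemma pol_singleton [simp]: "pol {I} w = sqmon I w"
  by (simp add: pol_def)

lemma pol_cong: "(\<And>I i. I \<in> S \<Longrightarrow> i \<in> I \<Longrightarrow> w i = v i) \<Longrightarrow> pol S w = pol S v"
  unfolding pol_def by (intro sum.cong sqmon_cong) auto

lemma pol_below_cong:
  assumes "S \<subseteq> Pow {1..<k}" "\<And>i. 1 \<le> i \<Longrightarrow> i < k \<Longrightarrow> w i = v i"
  shows "pol S w = pol S v"
proof (rule pol_cong)
  fix I i assume "I \<in> S" "i \<in> I"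
  then have "i \<in> {1..<k}" using assms(1) by blast
  then show "w i = v i" using assms(2) by simp
qed

lemma pol_union_disjoint:
  "finite S \<Longrightarrow> finite S' \<Longrightarrow> S \<inter> S' = {} \<Longrightarrow> pol (S \<union> S') w = pol S w + pol S' w"
  by (simp add: pol_def sum.union_disjoint)

lemma pol_sym_diff:
  assumes "finite S" "finite S'"
  shows "pol (sym_diff S S') w = pol S w + pol S' w"
proof -
  have "pol S w = pol (S - S') w + pol (S \<inter> S') w"
    using assms by (subst pol_union_disjoint[symmetric]) (auto intro: arg_cong2[where f=pol])
  moreover have "pol S' w = pol (S' - S) w + pol (S \<inter> S') w"
    using assms by (subst pol_union_disjoint[symmetric]) (auto intro: arg_cong2[where f=pol])
  moreover have "pol (sym_diff S S') w = pol (S - S') w + pol (S' - S) w"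
    using assms by (subst pol_union_disjoint) auto
  ultimately show ?thesis by (simp add: ac_simps)
qed

lemma sqmon_mult_pol:
  assumes "finite J" "\<And>K. K \<in> S \<Longrightarrow> finite K"
  shows "sqmon J w * pol S w = (\<Sum>K\<in>S. sqmon (K \<union> J) w)"
  unfolding pol_def sum_distrib_left
  by (intro sum.cong refl) (simp add: assms sqmon_mult Un_commute)

text \<open>Evaluate at the letter whose coordinates vanish exactly on an inclusion-minimal member
  of \<open>S\<close>. A monomial is 1 there only if its index set is contained in that member, so
  the sum has a single nonzero term.\<close>

lemma pol_eq_0_imp_empty:
  assumes S: "S \<subseteq> Pow {1..n}" and 0: "\<And>w. w \<in> letters n \<Longrightarrow> pol S w = 0"
  shows "S = {}"
proof (rule ccontr)
  assume "S \<noteq> {}"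
  moreover have fin: "finite S" using S finite_subset by blast
  ultimately obtain I where "I \<in> S" "\<forall>J\<in>S. J \<subseteq> I \<longrightarrow> I = J"
    using finite_has_minimal[of S] by auto
  then have I: "I \<in> S" and min: "\<And>J. J \<in> S \<Longrightarrow> J \<subseteq> I \<Longrightarrow> J = I" by auto
  define w :: "nat \<Rightarrow> bit" where "w = (\<lambda>i\<in>{1..n}. if i \<in> I then 0 else 1)"
  have w: "w \<in> letters n" by (simp add: w_def letters_def)
  have "sqmon J w = (if J = I then 1 else 0)" if "J \<in> S" for J
  proof -
    have "J \<subseteq> {1..n}" using that S by auto
    moreover from this have "finite J" using finite_subset by blast
    moreover have "w i = 0 \<longleftrightarrow> i \<in> I" if "i \<in> J" for i
      using that \<open>J \<subseteq> {1..n}\<close> by (auto simp: w_def)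
    ultimately have "sqmon J w = (if J \<subseteq> I then 1 else 0)"
      by (auto simp: sqmon_eq)
    then show ?thesis using min[OF that] by auto
  qed
  then have "pol S w = 1" using I fin by (simp add: pol_def)
  then show False using 0[OF w] by simp
qed

lemma pol_inject:
  assumes "S \<subseteq> Pow {1..n}" "S' \<subseteq> Pow {1..n}" "\<And>w. w \<in> letters n \<Longrightarrow> pol S w = pol S' w"
  shows "S = S'"
proof -
  have "finite S" "finite S'" using assms finite_subset by blast+
  then have "sym_diff S S' = {}"
    using assms by (intro pol_eq_0_imp_empty[of _ n]) (auto simp: pol_sym_diff)
  then show ?thesis by auto
qed

section \<open>Spans of sets of monomials\<close>

lemma spanned_cong:
  "(\<And>w. w \<in> letters n \<Longrightarrow> p w = q w) \<Longrightarrow> p \<in> spanned n C \<longleftrightarrow> q \<in> spanned n C"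
  by (simp add: spanned_def)

lemma pol_in_spanned: "S \<subseteq> C \<Longrightarrow> pol S \<in> spanned n C"
  by (auto simp: spanned_def)

lemma sqmon_in_spanned: "I \<in> C \<Longrightarrow> sqmon I \<in> spanned n C"
  using pol_in_spanned[of "{I}" C n] by (simp cong: spanned_cong)

lemma zero_in_spanned: "(\<lambda>w. 0) \<in> spanned n C"
  using pol_in_spanned[of "{}" C n] by (simp cong: spanned_cong)

lemma spanned_add:
  assumes "finite C" "p \<in> spanned n C" "q \<in> spanned n C"
  shows "(\<lambda>w. p w + q w) \<in> spanned n C"
proof -
  obtain S S' where S: "S \<subseteq> C" "S' \<subseteq> C"
    and eq: "\<And>w. w \<in> letters n \<Longrightarrow> p w = pol S w" "\<And>w. w \<in> letters n \<Longrightarrow> q w = pol S' w"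
    using assms by (auto simp: spanned_def)
  have "finite S" "finite S'" using S assms(1) finite_subset by blast+
  then have "p w + q w = pol (sym_diff S S') w" if "w \<in> letters n" for w
    using that by (simp add: eq pol_sym_diff)
  moreover have "sym_diff S S' \<subseteq> C" using S by auto
  ultimately show ?thesis unfolding spanned_def by blast
qed

lemma spanned_sum:
  assumes "finite C" "\<And>a. a \<in> A \<Longrightarrow> f a \<in> spanned n C"
  shows "(\<lambda>w. \<Sum>a\<in>A. f a w) \<in> spanned n C"
  using assms(2)
proof (induction A rule: infinite_finite_induct)
  case (insert a A)
  then have "(\<lambda>w. f a w + (\<Sum>a\<in>A. f a w)) \<in> spanned n C"
    by (intro spanned_add assms(1)) simp_all
  then show ?case using insert.hyps by simp
qed (simp_all add: zero_in_spanned)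

lemma pol_in_spanned_iff:
  assumes "S \<subseteq> Pow {1..n}" "C \<subseteq> Pow {1..n}"
  shows "pol S \<in> spanned n C \<longleftrightarrow> S \<subseteq> C"
proof
  assume "pol S \<in> spanned n C"
  then obtain S' where "S' \<subseteq> C" "\<And>w. w \<in> letters n \<Longrightarrow> pol S w = pol S' w"
    by (auto simp: spanned_def)
  then show "S \<subseteq> C" using pol_inject[of S n S'] assms by blast
qed (rule pol_in_spanned)

lemma spanned_compose:
  assumes "finite C" "\<And>I. I \<in> C \<Longrightarrow> (\<lambda>w. sqmon I (\<phi> w)) \<in> spanned n D" "finite D"
    and "\<And>w. w \<in> letters n \<Longrightarrow> \<phi> w \<in> letters n" "p \<in> spanned n C"
  shows "(\<lambda>w. p (\<phi> w)) \<in> spanned n D"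
proof -
  obtain S where S: "S \<subseteq> C" "\<And>w. w \<in> letters n \<Longrightarrow> p w = pol S w"
    using assms by (auto simp: spanned_def)
  have "(\<lambda>w. \<Sum>I\<in>S. sqmon I (\<phi> w)) \<in> spanned n D"
    using S assms by (intro spanned_sum) auto
  then show ?thesis
    by (rule spanned_cong[THEN iffD2, rotated]) (simp add: S assms pol_def)
qed

text \<open>Setting \<open>w j\<close> to 1 makes \<open>y\<^sub>j\<close> vanish. The sum thus
  retains exactly the monomials of \<open>p\<close> that contain \<open>j\<close>: it is the part of
  degree one in \<open>y\<^sub>j\<close>.\<close>

lemma spanned_restrict_coordinate:
  assumes C: "C \<subseteq> Pow {1..n}" and p: "p \<in> spanned n C" and j: "j \<in> {1..n}"
  shows "(\<lambda>w. p w + p (w(j := 1))) \<in> spanned n C"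
proof (rule spanned_add)
  show "finite C" using C finite_subset by blast
  have "sqmon I (w(j := 1)) = (if j \<in> I then 0 else sqmon I w)" if "I \<in> C" for I w
    using C that by (auto simp: sqmon_remove[of I j] finite_subset intro!: sqmon_cong)
  then have "(\<lambda>w. sqmon I (w(j := 1))) \<in> spanned n C" if "I \<in> C" for I
    using that by (cases "j \<in> I") (simp_all add: zero_in_spanned sqmon_in_spanned)
  then show "(\<lambda>w. p (w(j := 1))) \<in> spanned n C"
    by (rule spanned_compose[OF \<open>finite C\<close> _ \<open>finite C\<close> letters_update p]) (use j in auto)
qed (rule p)

text \<open>Products with \<open>J\<close> can cancel: if \<open>Q\<close> consists of
  \<open>{}\<close> and \<open>{l}\<close>, then multiplying by \<open>y\<^sub>l\<close> gives 0.
  Having the multiples by all subsets of \<open>J\<close> allows a factor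
  \<open>1 + y\<^sub>l\<close> for each \<open>l\<close> that \<open>K\<close> lacks, and this
  factor removes the competing monomials.\<close>

lemma union_in_if_multiples_spanned:
  assumes "finite J" "J \<subseteq> {1..n}" "Q \<subseteq> Pow {1..n}" "C \<subseteq> Pow {1..n}"
    and "\<And>J'. J' \<subseteq> J \<Longrightarrow> (\<lambda>w. sqmon J' w * pol Q w) \<in> spanned n C" "K \<in> Q"
  shows "K \<union> J \<in> C"
  using assms(1-3,5,6)
proof (induction J arbitrary: Q K rule: finite_induct)
  case empty
  then have "pol Q \<in> spanned n C" using empty.prems(3)[of "{}"] by (simp cong: spanned_cong)
  then show ?case using empty assms(4) pol_in_spanned_iff[of Q n C] by auto
next
  case (insert l J)
  have finQ: "finite Q" using insert.prems finite_subset by blast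
  have finC: "finite C" using assms(4) finite_subset by blast
  have finK: "finite K" if "K \<in> Q" for K using insert.prems(2) that finite_subset by blast
  show ?case
  proof (cases "l \<in> K")
    case True
    have "K \<union> J \<in> C" using insert.prems by (intro insert.IH[of Q]) auto
    then show ?thesis using True by (simp add: insert_absorb)
  next
    case False
    let ?Q0 = "{K\<in>Q. l \<notin> K}" and ?Q1 = "{K\<in>Q. l \<in> K}"
    \<comment> \<open>Multiplication by \<open>1 + y\<^sub>l\<close> kills \<open>?Q1\<close>, as
      \<open>y\<^sub>l\<close> is idempotent, and sends \<open>?Q0\<close> to \<open>?R\<close>,
      which contains \<open>insert l K\<close>.\<close>
    let ?R = "?Q0 \<union> insert l ` ?Q0"
    have inj: "inj_on (insert l) ?Q0" by (rule inj_onI) (auto dest: insert_ident)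
    have "pol ?R w = pol Q w + sqmon {l} w * pol Q w" for w
    proof -
      have "pol Q w = pol (?Q0 \<union> ?Q1) w" by (rule arg_cong2[where f=pol]) auto
      then have Q: "pol Q w = pol ?Q0 w + pol ?Q1 w"
        using finQ by (subst (asm) pol_union_disjoint) auto
      have "sqmon {l} w * pol ?Q0 w = pol (insert l ` ?Q0) w"
        using inj finK by (subst sqmon_mult_pol) (auto simp: pol_def sum.reindex)
      moreover have "sqmon {l} w * pol ?Q1 w = pol ?Q1 w"
        using finK by (subst sqmon_mult_pol) (auto simp: pol_def insert_absorb)
      moreover have "pol ?R w = pol ?Q0 w + pol (insert l ` ?Q0) w"
        using finQ by (intro pol_union_disjoint) auto
      ultimately show ?thesis by (simp only: Q distrib_left) (rule bit_add_cancel_middle)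
    qed
    then have eq: "sqmon J' w * pol ?R w = sqmon J' w * pol Q w + sqmon (insert l J') w * pol Q w"
      if "J' \<subseteq> J" for J' w
    proof -
      have "finite J'" using that insert.hyps finite_subset by blast
      then have "sqmon (insert l J') w = sqmon J' w * sqmon {l} w"
        by (subst sqmon_mult) auto
      then show ?thesis using \<open>pol ?R w = _\<close> by (simp add: algebra_simps)
    qed
    have "insert l K \<union> J \<in> C"
    proof (rule insert.IH[of ?R])
      show "?R \<subseteq> Pow {1..n}" using insert.prems by auto
      show "insert l K \<in> ?R" using insert.prems False by auto
      show "(\<lambda>w. sqmon J' w * pol ?R w) \<in> spanned n C" if "J' \<subseteq> J" for J'
        unfolding eq[OF that] using that insert.prems(3)[of J'] insert.prems(3)[of "insert l J'"]
        by (intro spanned_add finC) auto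
    qed (use insert.prems in auto)
    then show ?thesis by simp
  qed
qed

section \<open>Unitriangular permutations\<close>

definition triangular :: "nat \<Rightarrow> (nat \<Rightarrow> nat set set) \<Rightarrow> bool" where
  "triangular n H \<longleftrightarrow> (\<forall>k\<in>{1..n}. H k \<subseteq> Pow {1..<k})"

text \<open>Replacing a factor \<open>y\<^sub>j\<close> by a monomial yields the union of the index
  sets even if they overlap, since each \<open>y\<^sub>i\<close> is idempotent as a
  function.\<close>

definition substitution_closed :: "nat \<Rightarrow> (nat \<Rightarrow> nat set set) \<Rightarrow> bool" where
  "substitution_closed n H \<longleftrightarrow>
     (\<forall>k\<in>{1..n}. \<forall>I\<in>H k. \<forall>j\<in>I. \<forall>J\<in>H j. (I - {j}) \<union> J \<in> H k)"

text \<open>All polynomials are evaluated at the original letter. Adding to \<open>w k\<close> is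
  the same as adding to \<open>y\<^sub>k\<close>, since the two differ by the constant 1.\<close>

definition act :: "nat \<Rightarrow> (nat \<Rightarrow> nat set set) \<Rightarrow> perm2" where
  "act n P = (\<lambda>w\<in>letters n. \<lambda>k\<in>{1..n}. w k + pol (P k) w)"

definition transv :: "nat \<Rightarrow> nat \<Rightarrow> nat set set \<Rightarrow> perm2" where
  "transv n j S = act n ((\<lambda>_. {})(j := S))"

text \<open>Stated through the functions \<open>g w k + w k\<close>, so that closure under
  composition becomes a statement about spans; \<open>unitri_iff\<close> gives the form by index
  sets.\<close>

definition unitri :: "nat \<Rightarrow> (nat \<Rightarrow> nat set set) \<Rightarrow> perm2 set" where
  "unitri n H =
     {g \<in> letters n \<rightarrow>\<^sub>E letters n. \<forall>k\<in>{1..n}. (\<lambda>w. g w k + w k) \<in> spanned n (H k)}"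

abbreviation Sym :: "nat \<Rightarrow> perm2 monoid" where
  "Sym n \<equiv> BijGroup (letters n)"

lemma triangular_finite: "triangular n H \<Longrightarrow> k \<in> {1..n} \<Longrightarrow> finite (H k)"
  unfolding triangular_def by (metis finite_Pow_iff finite_atLeastLessThan finite_subset)

lemma triangularD: "triangular n H \<Longrightarrow> k \<in> {1..n} \<Longrightarrow> I \<in> H k \<Longrightarrow> I \<subseteq> {1..<k}"
  unfolding triangular_def by blast

lemma triangular_finite_mem: "triangular n H \<Longrightarrow> k \<in> {1..n} \<Longrightarrow> I \<in> H k \<Longrightarrow> finite I"
  by (meson triangularD finite_atLeastLessThan finite_subset)

lemma triangular_Pow: "triangular n H \<Longrightarrow> k \<in> {1..n} \<Longrightarrow> H k \<subseteq> Pow {1..n}"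
  by (fastforce dest: triangularD)

lemma triangular_subset: "triangular n H \<Longrightarrow> (\<And>k. k \<in> {1..n} \<Longrightarrow> P k \<subseteq> H k) \<Longrightarrow> triangular n P"
  unfolding triangular_def by blast

lemma substitution_closedD:
  "substitution_closed n H \<Longrightarrow> k \<in> {1..n} \<Longrightarrow> I \<in> H k \<Longrightarrow> j \<in> I \<Longrightarrow> J \<in> H j \<Longrightarrow> (I - {j}) \<union> J \<in> H k"
  unfolding substitution_closed_def by blast

lemma letters_eqI:
  "w \<in> letters n \<Longrightarrow> v \<in> letters n \<Longrightarrow> (\<And>k. k \<in> {1..n} \<Longrightarrow> w k = v k) \<Longrightarrow> w = v"
  unfolding letters_def by (rule PiE_ext)

lemma letter_arb: "w \<in> letters n \<Longrightarrow> k \<notin> {1..n} \<Longrightarrow> w k = undefined"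
  unfolding letters_def by (rule PiE_arb)

lemma act_apply: "w \<in> letters n \<Longrightarrow> act n P w = (\<lambda>k\<in>{1..n}. w k + pol (P k) w)"
  by (simp only: act_def restrict_apply if_True)

lemma act_coord: "w \<in> letters n \<Longrightarrow> k \<in> {1..n} \<Longrightarrow> act n P w k = w k + pol (P k) w"
  by (simp only: act_apply restrict_apply if_True)

lemma act_in_letters: "w \<in> letters n \<Longrightarrow> act n P w \<in> letters n"
  by (simp only: act_apply) (simp add: letters_def)

lemma act_cong: "(\<And>k. k \<in> {1..n} \<Longrightarrow> P k = Q k) \<Longrightarrow> act n P = act n Q"
  unfolding act_def by (intro restrict_ext) simp

lemma transv_apply:
  assumes "w \<in> letters n" "j \<in> {1..n}"
  shows "transv n j S w = w(j := w j + pol S w)"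
  unfolding transv_def
  by (rule letters_eqI[of _ n]) (use assms in \<open>auto simp: act_in_letters letters_update act_coord\<close>)

lemma transv_in_letters: "w \<in> letters n \<Longrightarrow> transv n j S w \<in> letters n"
  unfolding transv_def by (rule act_in_letters)

lemma unitri_iff: "g \<in> unitri n H \<longleftrightarrow> (\<exists>P. (\<forall>k\<in>{1..n}. P k \<subseteq> H k) \<and> g = act n P)"
proof
  assume g: "g \<in> unitri n H"
  then have "\<forall>k\<in>{1..n}. \<exists>S\<subseteq>H k. \<forall>w\<in>letters n. g w k + w k = pol S w"
    unfolding unitri_def spanned_def by blast
  then obtain P where P: "\<And>k. k \<in> {1..n} \<Longrightarrow> P k \<subseteq> H k \<and> (\<forall>w\<in>letters n. g w k + w k = pol (P k) w)"
    by metis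
  have gE: "g \<in> letters n \<rightarrow>\<^sub>E letters n" using g unfolding unitri_def by blast
  have "g = act n P"
  proof
    fix w
    show "g w = act n P w"
    proof (cases "w \<in> letters n")
      case True
      have "g w k = act n P w k" if "k \<in> {1..n}" for k
      proof -
        have "g w k + w k = pol (P k) w" using P that True by blast
        then show ?thesis using True that by (simp add: act_coord bit_add_eq_iff)
      qed
      then show ?thesis using gE True by (intro letters_eqI[of _ n] act_in_letters) auto
    next
      case False
      then show ?thesis using PiE_arb[OF gE] by (simp add: act_def)
    qed
  qed
  then show "\<exists>P. (\<forall>k\<in>{1..n}. P k \<subseteq> H k) \<and> g = act n P" using P by blast
next
  assume "\<exists>P. (\<forall>k\<in>{1..n}. P k \<subseteq> H k) \<and> g = act n P"
  then obtain P where P: "\<And>k. k \<in> {1..n} \<Longrightarrow> P k \<subseteq> H k" and g: "g = act n P" by blast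
  have "g \<in> letters n \<rightarrow>\<^sub>E letters n"
    unfolding g by (rule PiE_I) (simp_all add: act_in_letters, simp add: act_def)
  moreover have "(\<lambda>w. g w k + w k) \<in> spanned n (H k)" if "k \<in> {1..n}" for k
  proof -
    have "g w k + w k = pol (P k) w" if "w \<in> letters n" for w
      unfolding g using that \<open>k \<in> _\<close> by (simp add: act_coord bit_add_eq_iff add.commute)
    then show ?thesis unfolding spanned_def using P[OF that] by blast
  qed
  ultimately show "g \<in> unitri n H" unfolding unitri_def by blast
qed

lemma act_in_unitri: "(\<And>k. k \<in> {1..n} \<Longrightarrow> P k \<subseteq> H k) \<Longrightarrow> act n P \<in> unitri n H"
  unfolding unitri_iff by blast

lemma act_inject:
  assumes "triangular n P" "triangular n Q" "act n P = act n Q" "k \<in> {1..n}"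
  shows "P k = Q k"
proof (rule pol_inject)
  show "P k \<subseteq> Pow {1..n}" "Q k \<subseteq> Pow {1..n}" using assms triangular_Pow by blast+
  show "pol (P k) w = pol (Q k) w" if "w \<in> letters n" for w
    using that assms(4) act_coord[of w n k P] act_coord[of w n k Q] assms(3) by simp
qed

lemma act_in_unitri_iff:
  assumes "triangular n P" "triangular n H"
  shows "act n P \<in> unitri n H \<longleftrightarrow> (\<forall>k\<in>{1..n}. P k \<subseteq> H k)"
proof
  assume "act n P \<in> unitri n H"
  then obtain Q where Q: "\<forall>k\<in>{1..n}. Q k \<subseteq> H k" "act n P = act n Q" unfolding unitri_iff by blast
  then have "triangular n Q" using triangular_subset[OF assms(2)] by blast
  then show "\<forall>k\<in>{1..n}. P k \<subseteq> H k" using act_inject[OF assms(1) _ Q(2)] Q(1) by blast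
qed (blast intro: act_in_unitri)

lemma triangular_fun_upd: "S \<subseteq> Pow {1..<j} \<Longrightarrow> triangular n ((\<lambda>_. {})(j := S))"
  unfolding triangular_def by simp

lemma transv_in_unitri: "S \<subseteq> H j \<Longrightarrow> transv n j S \<in> unitri n H"
  unfolding transv_def by (rule act_in_unitri) simp

lemma transv_in_unitri_iff:
  assumes "triangular n H" "j \<in> {1..n}" "S \<subseteq> Pow {1..<j}"
  shows "transv n j S \<in> unitri n H \<longleftrightarrow> S \<subseteq> H j"
  unfolding transv_def act_in_unitri_iff[OF triangular_fun_upd[OF assms(3)] assms(1)] using assms(2) by auto

section \<open>Transvections as involutions and as factors of unitriangular maps\<close>

lemma transv_comp_self:
  assumes "j \<in> {1..n}" "S \<subseteq> Pow {1..<j}" "w \<in> letters n"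
  shows "transv n j S (transv n j S w) = w"
proof -
  have "pol S (w(j := c)) = pol S w" for c by (rule pol_below_cong[OF assms(2)]) simp
  then show ?thesis using assms
    by (simp add: transv_apply letters_update add.assoc)
qed

lemma transv_extensional: "transv n j S \<in> extensional (letters n)"
  unfolding transv_def act_def by (rule restrict_extensional)

lemma transv_Bij:
  assumes "j \<in> {1..n}" "S \<subseteq> Pow {1..<j}"
  shows "transv n j S \<in> Bij (letters n)"
  unfolding Bij_def
  using bij_betw_byWitness[of "letters n" "transv n j S" "transv n j S" "letters n"] transv_comp_self[OF assms]
    transv_extensional transv_in_letters by blast

lemma Sym_mult: "a \<in> Bij (letters n) \<Longrightarrow> b \<in> Bij (letters n) \<Longrightarrow> a \<otimes>\<^bsub>Sym n\<^esub> b = compose (letters n) a b"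
  by (simp add: BijGroup_def)

lemma Sym_one: "\<one>\<^bsub>Sym n\<^esub> = (\<lambda>w\<in>letters n. w)"
  by (simp add: BijGroup_def)

lemma Sym_carrier: "carrier (Sym n) = Bij (letters n)"
  by (simp add: BijGroup_def)

lemma act_empty: "act n (\<lambda>_. {}) = \<one>\<^bsub>Sym n\<^esub>"
  unfolding Sym_one act_def
proof (rule restrict_ext)
  show "(\<lambda>k\<in>{1..n}. w k + pol {} w) = w" if "w \<in> letters n" for w
    using that by (intro ext) (simp add: letter_arb)
qed

lemma transv_empty: "transv n k {} = \<one>\<^bsub>Sym n\<^esub>"
  unfolding act_empty[symmetric] transv_def by (rule act_cong) simp

lemma transv_mult_self:
  assumes "j \<in> {1..n}" "S \<subseteq> Pow {1..<j}"
  shows "transv n j S \<otimes>\<^bsub>Sym n\<^esub> transv n j S = \<one>\<^bsub>Sym n\<^esub>"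
  using assms transv_comp_self[OF assms] by (auto simp: Sym_mult transv_Bij Sym_one compose_def)

lemma transv_inv:
  assumes "j \<in> {1..n}" "S \<subseteq> Pow {1..<j}"
  shows "inv\<^bsub>Sym n\<^esub> (transv n j S) = transv n j S"
  using group.inv_equality[OF group_BijGroup transv_mult_self[OF assms]] transv_Bij[OF assms] by (simp add: Sym_carrier)

text \<open>The transvection acts first. It alters only the coordinate \<open>Suc j\<close>, on
  which none of the polynomials of \<open>P k\<close> with \<open>k \<le> j\<close> depends.\<close>

lemma act_step:
  assumes P: "triangular n P" and j: "Suc j \<le> n"
  shows "act n (\<lambda>k. if k \<le> Suc j then P k else {}) =
    compose (letters n) (act n (\<lambda>k. if k \<le> j then P k else {})) (transv n (Suc j) (P (Suc j)))"
    (is "_ = compose _ ?a ?e")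
proof
  fix w
  show "act n (\<lambda>k. if k \<le> Suc j then P k else {}) w = compose (letters n) ?a ?e w"
  proof (cases "w \<in> letters n")
    case w: True
    let ?v = "w(Suc j := w (Suc j) + pol (P (Suc j)) w)"
    have e: "?e w = ?v" using w j by (intro transv_apply) auto
    have v: "?v \<in> letters n" using w j by (intro letters_update) auto
    have "act n (\<lambda>k. if k \<le> Suc j then P k else {}) w k = ?a ?v k" if k: "k \<in> {1..n}" for k
    proof -
      have "pol (P k) ?v = pol (P k) w" if "k \<le> j"
      proof (rule pol_below_cong)
        show "P k \<subseteq> Pow {1..<k}" using P k unfolding triangular_def by blast
      qed (use that in auto)
      then show ?thesis unfolding act_coord[OF w k] act_coord[OF v k] by (auto simp: le_Suc_eq)
    qed
    then show ?thesis unfolding compose_def using w v e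
      by (simp only: restrict_apply if_True) (intro letters_eqI[of _ n] act_in_letters)
  qed (simp add: act_def compose_def)
qed

lemma act_Bij:
  assumes P: "triangular n P"
  shows "act n P \<in> Bij (letters n)"
proof -
  have "act n (\<lambda>k. if k \<le> j then P k else {}) \<in> Bij (letters n)" if "j \<le> n" for j
    using that
  proof (induction j)
    case 0
    have "act n (\<lambda>k. if k \<le> 0 then P k else {}) = act n (\<lambda>_. {})" by (rule act_cong) simp
    then show ?case using id_Bij unfolding act_empty Sym_one by metis
  next
    case (Suc j)
    have "transv n (Suc j) (P (Suc j)) \<in> Bij (letters n)"
      using P Suc.prems unfolding triangular_def by (intro transv_Bij) auto
    then show ?case unfolding act_step[OF P Suc.prems] using Suc by (intro compose_Bij) auto
  qed
  from this[of n] have "act n (\<lambda>k. if k \<le> n then P k else {}) \<in> Bij (letters n)" by simp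
  moreover have "act n (\<lambda>k. if k \<le> n then P k else {}) = act n P" by (rule act_cong) simp
  ultimately show ?thesis by metis
qed

lemma unitri_Bij: "triangular n H \<Longrightarrow> unitri n H \<subseteq> Bij (letters n)"
  using act_Bij triangular_subset[of n H] by (auto simp: unitri_iff)

section \<open>Substitution of unitriangular maps into polynomials\<close>

lemma sqmon_transv:
  assumes "w \<in> letters n" "j \<in> {1..n}" "finite I"
  shows "sqmon I (transv n j S w) = (if j \<in> I then sqmon I w + sqmon (I - {j}) w * pol S w else sqmon I w)"
proof (cases "j \<in> I")
  case True
  have "sqmon (I - {j}) (w(j := c)) = sqmon (I - {j}) w" for c by (rule sqmon_cong) auto
  then have "sqmon I (transv n j S w) = (w j + pol S w + 1) * sqmon (I - {j}) w"
    using True assms by (subst sqmon_remove[of I j]) (simp_all add: transv_apply)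
  then show ?thesis using True assms sqmon_remove[of I j w] by (simp add: algebra_simps)
next
  case False
  then show ?thesis using assms by (simp add: transv_apply) (rule sqmon_cong, auto)
qed

text \<open>The polynomial is linear in \<open>y\<^sub>j\<close>, so adding a monomial to
  \<open>y\<^sub>j\<close> changes it by that monomial times the partial derivative with respect to
  \<open>y\<^sub>j\<close>, which is the last factor.\<close>

lemma pol_transv:
  assumes Q: "Q \<subseteq> Pow {1..n}" and j: "j \<in> {1..n}" and J: "finite J" and w: "w \<in> letters n"
  shows "pol Q (transv n j {J} w) + pol Q w = sqmon J w * pol ((\<lambda>I. I - {j}) ` {I\<in>Q. j \<in> I}) w"
proof -
  have finQ: "finite Q" using Q finite_subset by blast
  have fin: "finite I" if "I \<in> Q" for I using Q that finite_subset by blast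
  have "pol Q (transv n j {J} w) = (\<Sum>I\<in>Q. sqmon I w + (if j \<in> I then sqmon J w * sqmon (I - {j}) w else 0))"
    unfolding pol_def using fin by (intro sum.cong refl) (simp add: sqmon_transv[OF w j] mult.commute)
  also have "\<dots> = pol Q w + (\<Sum>I\<in>{I\<in>Q. j \<in> I}. sqmon J w * sqmon (I - {j}) w)"
    using finQ by (simp add: sum.distrib pol_def sum.inter_filter)
  also have "(\<Sum>I\<in>{I\<in>Q. j \<in> I}. sqmon J w * sqmon (I - {j}) w) =
      sqmon J w * pol ((\<lambda>I. I - {j}) ` {I\<in>Q. j \<in> I}) w"
  proof -
    have "inj_on (\<lambda>I. I - {j}) {I\<in>Q. j \<in> I}" by (rule inj_onI) blast
    then show ?thesis by (simp add: pol_def sum.reindex sum_distrib_left)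
  qed
  finally show ?thesis by (simp add: ac_simps)
qed

text \<open>A monomial \<open>I\<close> containing \<open>j\<close> is mapped to itself plus the
  unions of \<open>I - {j}\<close> with the members of \<open>S\<close>; substitution closure keeps
  all of these in \<open>H k\<close>.\<close>

lemma spanned_transv:
  assumes H: "triangular n H" "substitution_closed n H" and jk: "j \<in> {1..n}" "k \<in> {1..n}"
    and S: "S \<subseteq> H j" and p: "p \<in> spanned n (H k)"
  shows "(\<lambda>w. p (transv n j S w)) \<in> spanned n (H k)"
proof (rule spanned_compose[OF _ _ _ transv_in_letters p])
  show fin: "finite (H k)" "finite (H k)" using triangular_finite H jk by blast+
  fix I assume I: "I \<in> H k"
  have finI: "finite I" using I H jk triangular_finite_mem by blast
  have finJ: "finite J" if "J \<in> S" for J using that S H jk triangular_finite_mem by blast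
  show "(\<lambda>w. sqmon I (transv n j S w)) \<in> spanned n (H k)"
  proof (cases "j \<in> I")
    case True
    have "J \<union> (I - {j}) \<in> H k" if "J \<in> S" for J
      using substitution_closedD[OF H(2) jk(2) I True] that S by (auto simp: Un_commute)
    then have "(\<lambda>w. sqmon I w + (\<Sum>J\<in>S. sqmon (J \<union> (I - {j})) w)) \<in> spanned n (H k)"
      using fin I by (intro spanned_add spanned_sum sqmon_in_spanned) auto
    then show ?thesis
      using jk by (elim spanned_cong[THEN iffD1, rotated])
        (simp add: sqmon_transv finI True sqmon_mult_pol finJ)
  next
    case False
    have "sqmon I \<in> spanned n (H k)" using I by (rule sqmon_in_spanned)
    then show ?thesis
      using jk by (elim spanned_cong[THEN iffD1, rotated]) (simp add: sqmon_transv finI False)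
  qed
qed

text \<open>By \<open>act_step\<close> the map is a composite of transvections, and
  \<open>spanned_transv\<close> handles them one after another.\<close>

lemma spanned_unitri:
  assumes H: "triangular n H" "substitution_closed n H" and k: "k \<in> {1..n}"
    and g: "g \<in> unitri n H" and p: "p \<in> spanned n (H k)"
  shows "(\<lambda>w. p (g w)) \<in> spanned n (H k)"
proof -
  obtain P where P: "\<And>k. k \<in> {1..n} \<Longrightarrow> P k \<subseteq> H k" and g: "g = act n P"
    using g unfolding unitri_iff by blast
  have tri: "triangular n P" using triangular_subset[OF H(1) P] by blast
  have "(\<lambda>w. p (act n (\<lambda>k. if k \<le> j then P k else {}) w)) \<in> spanned n (H k)" if "j \<le> n" for j
    using that
  proof (induction j)
    case 0
    have "act n (\<lambda>k. if k \<le> 0 then P k else {}) = act n (\<lambda>_. {})" by (rule act_cong) simp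
    then show ?case using p
      by (intro spanned_cong[THEN iffD1, OF _ p]) (simp add: act_empty Sym_one)
  next
    case (Suc j)
    then have "(\<lambda>w. p (act n (\<lambda>k. if k \<le> j then P k else {}) (transv n (Suc j) (P (Suc j)) w))) \<in> spanned n (H k)"
      using P by (intro spanned_transv[OF H _ k]) auto
    then show ?case
      by (rule spanned_cong[THEN iffD1, rotated]) (simp add: act_step[OF tri Suc.prems] compose_def)
  qed
  from this[of n] have "(\<lambda>w. p (act n (\<lambda>k. if k \<le> n then P k else {}) w)) \<in> spanned n (H k)" by simp
  moreover have "act n (\<lambda>k. if k \<le> n then P k else {}) = act n P" by (rule act_cong) simp
  ultimately show ?thesis unfolding g by metis
qed

lemma unitri_maps: "g \<in> unitri n H \<Longrightarrow> w \<in> letters n \<Longrightarrow> g w \<in> letters n"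
  unfolding unitri_def by blast

lemma unitri_compose:
  assumes H: "triangular n H" "substitution_closed n H" and g: "g \<in> unitri n H" and h: "h \<in> unitri n H"
  shows "compose (letters n) g h \<in> unitri n H"
proof -
  have "(\<lambda>w. compose (letters n) g h w k + w k) \<in> spanned n (H k)" if k: "k \<in> {1..n}" for k
  proof -
    have "(\<lambda>w. g w k + w k) \<in> spanned n (H k)" "(\<lambda>w. h w k + w k) \<in> spanned n (H k)"
      using g h k unfolding unitri_def by blast+
    \<comment> \<open>The value \<open>h w k\<close> is inserted: the first summand is the
      polynomial of \<open>g\<close> at \<open>k\<close> composed with \<open>h\<close>, the second
      is that of \<open>h\<close>.\<close>
    then have "(\<lambda>w. (g (h w) k + h w k) + (h w k + w k)) \<in> spanned n (H k)"
      using spanned_add[OF triangular_finite[OF H(1) k] spanned_unitri[OF H k h]] by blast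
    then show ?thesis
      by (rule spanned_cong[THEN iffD1, rotated]) (simp add: compose_def add.assoc)
  qed
  moreover have "compose (letters n) g h \<in> letters n \<rightarrow>\<^sub>E letters n"
    using unitri_maps[OF g] unitri_maps[OF h] by (auto simp: compose_def)
  ultimately show ?thesis unfolding unitri_def by blast
qed

text \<open>For a triangular family these are the rigid commutators based at \<open>k\<close> and
  punctured at the members of \<open>H k\<close>, see \<open>rigid_eq_transv\<close>.\<close>

definition gens :: "nat \<Rightarrow> (nat \<Rightarrow> nat set set) \<Rightarrow> perm2 set" where
  "gens n H = {transv n k {I} |k I. k \<in> {1..n} \<and> I \<in> H k}"

lemma gensI: "k \<in> {1..n} \<Longrightarrow> I \<in> H k \<Longrightarrow> transv n k {I} \<in> gens n H"
  unfolding gens_def by blast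

text \<open>The map is factored twice: \<open>act_step\<close> separates the coordinates, and a
  transvection by a polynomial is the product of those by its monomials, which do not involve the
  coordinate being changed.\<close>

lemma unitri_subset_generate:
  assumes H: "triangular n H"
  shows "unitri n H \<subseteq> generate (Sym n) (gens n H)"
proof
  interpret group "Sym n" by (rule group_BijGroup)
  let ?U = "generate (Sym n) (gens n H)"
  fix g assume "g \<in> unitri n H"
  then obtain P where P: "\<And>k. k \<in> {1..n} \<Longrightarrow> P k \<subseteq> H k" and g: "g = act n P"
    unfolding unitri_iff by blast
  have tri: "triangular n P" using triangular_subset[OF H P] by blast
  have transv: "transv n k S \<in> ?U" if "k \<in> {1..n}" "S \<subseteq> H k" "finite S" for k S
    using that(3,2)
  proof (induction S rule: finite_induct)
    case empty
    then show ?case by (simp add: transv_empty generate.one)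
  next
    case (insert I S)
    have sub: "S \<subseteq> Pow {1..<k}" "{I} \<subseteq> Pow {1..<k}"
      using insert.prems H that(1) unfolding triangular_def by blast+
    have "transv n k (insert I S) w = transv n k {I} (transv n k S w)" if w: "w \<in> letters n" for w
    proof -
      have "pol {I} (w(k := c)) = pol {I} w" for c by (rule pol_below_cong[OF sub(2)]) simp
      moreover have "pol (insert I S) w = pol S w + sqmon I w"
        using insert.hyps by (simp add: pol_def)
      ultimately show ?thesis using w \<open>k \<in> {1..n}\<close>
        by (simp add: transv_apply letters_update add.assoc)
    qed
    then have "transv n k (insert I S) = compose (letters n) (transv n k {I}) (transv n k S)"
      using transv_extensional[of n k "insert I S"]
      by (intro extensionalityI[of _ "letters n"]) (simp_all add: compose_def)
    also have "\<dots> = transv n k {I} \<otimes>\<^bsub>Sym n\<^esub> transv n k S"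
      using sub that(1) by (simp add: Sym_mult transv_Bij)
    also have "\<dots> \<in> ?U"
      by (rule generate.eng[OF generate.incl[OF gensI]]) (use insert that(1) in auto)
    finally show ?case .
  qed
  have "act n (\<lambda>k. if k \<le> j then P k else {}) \<in> ?U" if "j \<le> n" for j
    using that
  proof (induction j)
    case 0
    have "act n (\<lambda>k. if k \<le> 0 then P k else {}) = act n (\<lambda>_. {})" by (rule act_cong) simp
    then show ?case using generate.one unfolding act_empty by metis
  next
    case (Suc j)
    have S: "Suc j \<in> {1..n}" using Suc.prems by simp
    have "P (Suc j) \<subseteq> Pow {1..<Suc j}" using tri S unfolding triangular_def by blast
    then have "transv n (Suc j) (P (Suc j)) \<in> Bij (letters n)" by (rule transv_Bij[OF S])
    moreover have "act n (\<lambda>k. if k \<le> j then P k else {}) \<in> Bij (letters n)"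
      using triangular_subset[OF tri, of "\<lambda>k. if k \<le> j then P k else {}"] by (intro act_Bij) simp
    moreover have "transv n (Suc j) (P (Suc j)) \<in> ?U"
      by (rule transv[OF S P[OF S] triangular_finite[OF tri S]])
    moreover have "act n (\<lambda>k. if k \<le> j then P k else {}) \<in> ?U" using Suc by simp
    ultimately show ?case unfolding act_step[OF tri Suc.prems]
      using generate.eng[of _ "Sym n" "gens n H" "transv n (Suc j) (P (Suc j))"] Sym_mult by fastforce
  qed
  from this[of n] have "act n (\<lambda>k. if k \<le> n then P k else {}) \<in> ?U" by simp
  moreover have "act n (\<lambda>k. if k \<le> n then P k else {}) = act n P" by (rule act_cong) simp
  ultimately show "g \<in> ?U" unfolding g by metis
qed

lemma generate_subset_unitri:
  assumes H: "triangular n H" "substitution_closed n H"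
  shows "generate (Sym n) (gens n H) \<subseteq> unitri n H"
proof
  interpret group "Sym n" by (rule group_BijGroup)
  have gen: "g \<in> unitri n H" if "g \<in> gens n H" for g
    using that unfolding gens_def by (auto intro: transv_in_unitri)
  fix g assume "g \<in> generate (Sym n) (gens n H)"
  then show "g \<in> unitri n H"
  proof (induction rule: generate.induct)
    case one
    show ?case unfolding act_empty[symmetric] by (rule act_in_unitri) simp
  next
    case (incl h)
    then show ?case by (rule gen)
  next
    \<comment> \<open>The rules of \<open>generate\<close> invert only generators, and these are
      involutions.\<close>
    case (inv h)
    then have "inv\<^bsub>Sym n\<^esub> h = h"
      unfolding gens_def by (clarify, intro transv_inv) (use triangularD[OF H(1)] in blast)+
    then show ?case using gen inv by simp
  next
    case (eng h1 h2)
    then show ?case using unitri_Bij[OF H(1)] unitri_compose[OF H]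
      by (simp add: Sym_mult subset_iff)
  qed
qed

lemma unitri_eq_generate:
  "triangular n H \<Longrightarrow> substitution_closed n H \<Longrightarrow> unitri n H = generate (Sym n) (gens n H)"
  by (intro equalityI unitri_subset_generate generate_subset_unitri)

section \<open>Rigid commutators\<close>

text \<open>The largest triangular family; its group is the whole Sylow subgroup by
  \<open>carrier_Sylow2_eq_unitri\<close>.\<close>

definition full_family :: "nat \<Rightarrow> nat set set" where
  "full_family k = Pow {1..<k}"

lemma triangular_full: "triangular n full_family"
  by (simp add: triangular_def full_family_def)

lemma substitution_closed_full: "substitution_closed n full_family"
proof -
  have "(I - {j}) \<union> J \<subseteq> {1..<k}" if "I \<subseteq> {1..<k}" "j \<in> I" "J \<subseteq> {1..<j}" for I J j and k :: nat
  proof -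
    have "j < k" using that by auto
    then have "{1..<j} \<subseteq> {1..<k}" by auto
    then show ?thesis using that by blast
  qed
  then show ?thesis unfolding substitution_closed_def full_family_def by blast
qed

section \<open>Commutators of transvections\<close>

lemma commutator_closed:
  "group G \<Longrightarrow> a \<in> carrier G \<Longrightarrow> b \<in> carrier G \<Longrightarrow> commutator G a b \<in> carrier G"
  by (simp add: commutator_def group.inv_closed group.is_monoid monoid.m_closed)

text \<open>Transvections are involutions, so their commutator is the square of their
  product.\<close>

lemma commutator_transv_eq:
  assumes "j \<in> {1..n}" "k \<in> {1..n}" "S \<subseteq> Pow {1..<k}" "S' \<subseteq> Pow {1..<j}"
  shows "commutator (Sym n) (transv n k S) (transv n j S') =
    (\<lambda>w\<in>letters n. transv n k S (transv n j S' (transv n k S (transv n j S' w))))"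
proof -
  have B: "transv n k S \<in> Bij (letters n)" "transv n j S' \<in> Bij (letters n)"
    using assms transv_Bij by blast+
  show ?thesis
    unfolding commutator_def transv_inv[OF assms(2,3)] transv_inv[OF assms(1,4)]
    using B by (simp add: Sym_mult compose_Bij) (auto simp: compose_def transv_in_letters)
qed

lemma commutator_transv:
  assumes j: "1 \<le> j" "j < k" and k: "k \<le> n" and I: "I \<subseteq> {1..<k}" and J: "J \<subseteq> {1..<j}"
  shows "commutator (Sym n) (transv n k {I}) (transv n j {J}) =
    transv n k (if j \<in> I then {(I - {j}) \<union> J} else {})" (is "_ = transv n k ?S")
proof -
  have jn: "j \<in> {1..n}" and kn: "k \<in> {1..n}" using j k by auto
  have fin: "finite I" "finite J" using I J finite_subset by blast+
  have "transv n k {I} (transv n j {J} (transv n k {I} (transv n j {J} w))) = transv n k ?S w"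
    if w: "w \<in> letters n" for w
  proof -
    have cong_I: "sqmon I (v(k := c)) = sqmon I v" for v c
      using I by (intro sqmon_cong) auto
    have cong_J: "sqmon J (v(j := c)) = sqmon J v" "sqmon J (v(k := c)) = sqmon J v" for v c
      using J j by (intro sqmon_cong; auto)+
    \<comment> \<open>Coordinate \<open>j\<close> is altered by the first map and restored by the
      third; coordinate \<open>k\<close> receives \<open>sqmon I ?w1\<close> from the second and
      \<open>sqmon I w\<close> from the fourth. Their sum is computed by
      \<open>sqmon_transv\<close>.\<close>
    let ?w1 = "w(j := w j + sqmon J w)"
    have 1: "transv n j {J} w = ?w1"
      by (simp add: transv_apply[OF w jn])
    have l1: "?w1 \<in> letters n" by (rule letters_update[OF w jn])
    let ?w2 = "?w1(k := w k + sqmon I ?w1)"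
    have 2: "transv n k {I} ?w1 = ?w2"
      using j by (simp add: transv_apply[OF l1 kn])
    have l2: "?w2 \<in> letters n" by (rule letters_update[OF l1 kn])
    let ?w3 = "w(k := w k + sqmon I ?w1)"
    have 3: "transv n j {J} ?w2 = ?w3"
      using j by (auto simp: transv_apply[OF l2 jn] cong_J add.assoc fun_eq_iff)
    have l3: "?w3 \<in> letters n" by (rule letters_update[OF w kn])
    have 4: "transv n k {I} ?w3 = w(k := w k + (sqmon I ?w1 + sqmon I w))"
      by (simp add: transv_apply[OF l3 kn] cong_I add.assoc)
    have "sqmon I ?w1 + sqmon I w = pol ?S w"
      using sqmon_transv[OF w jn fin(1), of "{J}"] fin
      by (simp add: 1 sqmon_mult add.commute add.left_commute)
    then show ?thesis unfolding 1 2 3 4 transv_apply[OF w kn] by simp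
  qed
  moreover have "commutator (Sym n) (transv n k {I}) (transv n j {J}) =
      (\<lambda>w\<in>letters n. transv n k {I} (transv n j {J} (transv n k {I} (transv n j {J} w))))"
    using I J by (intro commutator_transv_eq[OF jn kn]) auto
  ultimately show ?thesis
    using transv_extensional[of n k ?S] by (intro extensionalityI[of _ "letters n"]) auto
qed

lemma commutator_transv_same:
  assumes k: "k \<in> {1..n}" and I: "I \<subseteq> {1..<k}" and J: "J \<subseteq> {1..<k}"
  shows "commutator (Sym n) (transv n k {I}) (transv n k {J}) = \<one>\<^bsub>Sym n\<^esub>"
proof -
  have "transv n k {I} (transv n k {J} (transv n k {I} (transv n k {J} w))) = w" if w: "w \<in> letters n" for w
  proof -
    have cong: "sqmon I (v(k := c)) = sqmon I v" "sqmon J (v(k := c)) = sqmon J v" for v c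
      using I J by (intro sqmon_cong; auto)+
    show ?thesis using w k
      by (simp add: transv_apply letters_update cong add.assoc)
  qed
  then show ?thesis
    using I J by (subst commutator_transv_eq[OF k k]) (auto simp: Sym_one)
qed

lemma commutator_transv_swap:
  assumes "j \<in> {1..n}" "k \<in> {1..n}" "I \<subseteq> {1..<k}" "J \<subseteq> {1..<j}"
  shows "commutator (Sym n) (transv n j {J}) (transv n k {I}) =
    inv\<^bsub>Sym n\<^esub> commutator (Sym n) (transv n k {I}) (transv n j {J})"
proof -
  interpret group "Sym n" by (rule group_BijGroup)
  have "transv n j {J} \<in> carrier (Sym n)" "transv n k {I} \<in> carrier (Sym n)"
    using transv_Bij[OF assms(1), of "{J}"] transv_Bij[OF assms(2), of "{I}"] assms(3,4)
    by (simp_all add: Sym_carrier)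
  then show ?thesis by (simp add: commutator_def inv_mult_group m_assoc)
qed

text \<open>The case \<open>k < j\<close> is reduced to \<open>j < k\<close> by swapping the
  arguments, which inverts the commutator; its value is an involution or the identity and hence
  unaffected.\<close>

lemma commutator_transv_cases:
  assumes j: "j \<in> {1..n}" and k: "k \<in> {1..n}" and I: "I \<subseteq> {1..<k}" and J: "J \<subseteq> {1..<j}"
  shows "commutator (Sym n) (transv n k {I}) (transv n j {J}) =
    (if j \<in> I then transv n k {(I - {j}) \<union> J}
     else if k \<in> J then transv n j {(J - {k}) \<union> I} else \<one>\<^bsub>Sym n\<^esub>)"
proof -
  consider "j < k" | "j = k" | "k < j" by linarith
  then show ?thesis
  proof cases
    case 1
    then have "k \<notin> J" using J by auto
    then show ?thesis using commutator_transv[of j k n I J] 1 assms by (simp add: transv_empty)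
  next
    case 2
    then have "j \<notin> I" "k \<notin> J" using I J by auto
    then show ?thesis using commutator_transv_same I J k 2 by simp
  next
    case 3
    interpret group "Sym n" by (rule group_BijGroup)
    have c: "commutator (Sym n) (transv n j {J}) (transv n k {I}) =
        transv n j (if k \<in> J then {(J - {k}) \<union> I} else {})" (is "_ = transv n j ?S")
      using 3 assms by (intro commutator_transv) auto
    have "?S \<subseteq> Pow {1..<j}" using I J 3 by auto
    then have "inv\<^bsub>Sym n\<^esub> transv n j ?S = transv n j ?S" by (rule transv_inv[OF j])
    moreover have "j \<notin> I" using 3 I by auto
    ultimately show ?thesis
      unfolding commutator_transv_swap[OF k j J I] c by (simp add: transv_empty)
  qed
qed

text \<open>The monomial of \<open>{1..<i}\<close> is 1 exactly when all coordinates before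
  \<open>i\<close> vanish, which is the condition in \<open>sgen\<close>.\<close>

lemma sgen_eq_transv:
  assumes i: "i \<in> {1..n}"
  shows "sgen n i = transv n i {{1..<i}}"
proof (rule extensionalityI[of _ "letters n"])
  show "sgen n i w = transv n i {{1..<i}} w" if "w \<in> letters n" for w
    using that by (simp add: transv_apply[OF that i] sgen_def sqmon_eq)
qed (simp_all add: transv_extensional sgen_def)

section \<open>The Sylow subgroup inside the symmetric group\<close>

lemma carrier_Sylow2: "carrier (Sylow2 n) = generate (Sym n) (sgen n ` {1..n})"
  by (simp add: Sylow2_def)

lemma mult_Sylow2: "(\<otimes>\<^bsub>Sylow2 n\<^esub>) = (\<otimes>\<^bsub>Sym n\<^esub>)"
  by (simp add: Sylow2_def)

lemma one_Sylow2: "\<one>\<^bsub>Sylow2 n\<^esub> = \<one>\<^bsub>Sym n\<^esub>"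
  by (simp add: Sylow2_def)

lemma sgen_Bij: "sgen n ` {1..n} \<subseteq> carrier (Sym n)"
  by (auto simp: Sym_carrier sgen_eq_transv intro!: transv_Bij)

lemma subgroup_Sylow2: "subgroup (carrier (Sylow2 n)) (Sym n)"
  unfolding carrier_Sylow2 using group.generate_is_subgroup[OF group_BijGroup sgen_Bij] .

lemma Sylow2_eq: "Sylow2 n = (Sym n)\<lparr>carrier := carrier (Sylow2 n)\<rparr>"
  by (simp add: Sylow2_def)

lemma group_Sylow2: "group (Sylow2 n)"
  by (subst Sylow2_eq) (rule group.subgroup_imp_group[OF group_BijGroup subgroup_Sylow2])

lemma inv_Sylow2: "a \<in> carrier (Sylow2 n) \<Longrightarrow> inv\<^bsub>Sylow2 n\<^esub> a = inv\<^bsub>Sym n\<^esub> a"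
  by (subst Sylow2_eq) (rule group.m_inv_consistent[OF group_BijGroup subgroup_Sylow2])

lemma commutator_Sylow2:
  "a \<in> carrier (Sylow2 n) \<Longrightarrow> b \<in> carrier (Sylow2 n) \<Longrightarrow>
    commutator (Sylow2 n) a b = commutator (Sym n) a b"
  by (simp add: commutator_def inv_Sylow2 mult_Sylow2)

lemma generate_Sylow2: "K \<subseteq> carrier (Sylow2 n) \<Longrightarrow> generate (Sylow2 n) K = generate (Sym n) K"
  by (subst Sylow2_eq) (rule group.generate_consistent[OF group_BijGroup _ subgroup_Sylow2])

lemma sgen_in_Sylow2: "i \<in> {1..n} \<Longrightarrow> sgen n i \<in> carrier (Sylow2 n)"
  unfolding carrier_Sylow2 by (simp add: generate.incl)

text \<open>Each further commutator with \<open>s\<^sub>x\<close> removes the factor \<open>x\<close> from the monomial: substituting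
  the monomial of all variables below \<open>x\<close> changes nothing else, as these variables still occur.\<close>

lemma foldl_commutator_sgen:
  assumes "b \<in> {1..n}" "sorted_wrt (>) xs" "set xs \<subseteq> K" "K \<subseteq> {1..<b}"
    "\<And>x. x \<in> set xs \<Longrightarrow> {1..<x} \<subseteq> K" "transv n b {K} \<in> carrier (Sylow2 n)"
  shows "foldl (commutator (Sylow2 n)) (transv n b {K}) (map (sgen n) xs) = transv n b {K - set xs}
    \<and> transv n b {K - set xs} \<in> carrier (Sylow2 n)"
  using assms(2-)
proof (induction xs arbitrary: K)
  case (Cons x xs)
  have x: "x \<in> K" "1 \<le> x" "x < b" using Cons.prems by auto
  then have xn: "x \<in> {1..n}" using assms(1) by auto
  have "commutator (Sylow2 n) (transv n b {K}) (sgen n x) = transv n b {(K - {x}) \<union> {1..<x}}"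
    unfolding commutator_Sylow2[OF Cons.prems(5) sgen_in_Sylow2[OF xn]]
    unfolding sgen_eq_transv[OF xn]
    using x Cons.prems(3) assms(1) by (subst commutator_transv) auto
  moreover have "(K - {x}) \<union> {1..<x} = K - {x}" using Cons.prems(4)[of x] by auto
  ultimately have c: "commutator (Sylow2 n) (transv n b {K}) (sgen n x) = transv n b {K - {x}}" by simp
  then have "transv n b {K - {x}} \<in> carrier (Sylow2 n)"
    using commutator_closed[OF group_Sylow2 Cons.prems(5) sgen_in_Sylow2[OF xn]] by simp
  moreover have "{1..<y} \<subseteq> K - {x}" if "y \<in> set xs" for y
    using that Cons.prems(1,4) by fastforce
  moreover have "set xs \<subseteq> K - {x}" using Cons.prems(1,2) by fastforce
  ultimately have "foldl (commutator (Sylow2 n)) (transv n b {K - {x}}) (map (sgen n) xs) =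
        transv n b {K - {x} - set xs} \<and> transv n b {K - {x} - set xs} \<in> carrier (Sylow2 n)"
    using Cons.prems by (intro Cons.IH) auto
  moreover have "K - {x} - set xs = K - set (x # xs)" by auto
  ultimately show ?case using c by simp
qed simp

text \<open>The commutator starts from \<open>sgen n b\<close>, whose monomial contains every index
  below \<open>b\<close>; the subsequent commutators remove those outside \<open>I\<close>.
  Membership in the carrier comes along because it allows the commutators to be computed in
  \<open>Sym n\<close>.\<close>

lemma rigid_eq_transv_aux:
  assumes b: "b \<in> {1..n}" and I: "I \<subseteq> {1..<b}"
  shows "rigid n b I = transv n b {I} \<and> transv n b {I} \<in> carrier (Sylow2 n)"
proof -
  let ?A = "{1..<b} - I"
  let ?xs = "rev (sorted_list_of_set ?A)"
  have desc: "sorted_wrt (>) ?xs" by (simp add: sorted_wrt_rev)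
  have set: "set ?xs = ?A" by simp
  have "sorted_list_of_set ({1..b} - I) = sorted_list_of_set ?A @ [b]"
    by (rule strict_sorted_equal) (use b I in \<open>auto simp: sorted_wrt_append\<close>)
  then have r: "rigid n b I = foldl (commutator (Sylow2 n)) (sgen n b) (map (sgen n) ?xs)"
    by (simp add: rigid_def set_commutator_def)
  have "foldl (commutator (Sylow2 n)) (transv n b {{1..<b}}) (map (sgen n) ?xs) =
      transv n b {{1..<b} - set ?xs} \<and> transv n b {{1..<b} - set ?xs} \<in> carrier (Sylow2 n)"
    using sgen_in_Sylow2[OF b] by (intro foldl_commutator_sgen b desc) (auto simp: sgen_eq_transv[OF b])
  moreover have "{1..<b} - ?A = I" using I by auto
  ultimately show ?thesis unfolding r set sgen_eq_transv[OF b] by simp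
qed

lemma rigid_eq_transv: "b \<in> {1..n} \<Longrightarrow> I \<subseteq> {1..<b} \<Longrightarrow> rigid n b I = transv n b {I}"
  using rigid_eq_transv_aux by blast

text \<open>Each \<open>sgen n i\<close> is an elementary transvection; conversely every elementary
  transvection is a rigid commutator and so lies in the Sylow subgroup.\<close>

lemma carrier_Sylow2_eq_unitri: "carrier (Sylow2 n) = unitri n full_family"
proof
  interpret group "Sym n" by (rule group_BijGroup)
  have "sgen n ` {1..n} \<subseteq> gens n full_family"
    by (auto simp: sgen_eq_transv full_family_def intro!: gensI)
  then show "carrier (Sylow2 n) \<subseteq> unitri n full_family"
    unfolding carrier_Sylow2 unitri_eq_generate[OF triangular_full substitution_closed_full]
    by (rule mono_generate)
  have "gens n full_family \<subseteq> carrier (Sylow2 n)"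
    using rigid_eq_transv_aux unfolding gens_def full_family_def by blast
  then show "unitri n full_family \<subseteq> carrier (Sylow2 n)"
    unfolding unitri_eq_generate[OF triangular_full substitution_closed_full]
    by (rule generate_subgroup_incl[OF _ subgroup_Sylow2])
qed

section \<open>Saturated subgroups and their orders\<close>

lemma unitri_mono:
  assumes "\<And>k. k \<in> {1..n} \<Longrightarrow> H k \<subseteq> H' k"
  shows "unitri n H \<subseteq> unitri n H'"
proof
  fix g assume "g \<in> unitri n H"
  then obtain P where P: "\<And>k. k \<in> {1..n} \<Longrightarrow> P k \<subseteq> H k" and g: "g = act n P"
    unfolding unitri_iff by blast
  have "P k \<subseteq> H' k" if "k \<in> {1..n}" for k using P[OF that] assms[OF that] by (rule order_trans)
  then show "g \<in> unitri n H'" unfolding g by (rule act_in_unitri)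
qed

lemma unitri_subset_carrier: "triangular n H \<Longrightarrow> unitri n H \<subseteq> carrier (Sylow2 n)"
  unfolding carrier_Sylow2_eq_unitri by (rule unitri_mono) (simp add: triangular_def full_family_def)

lemma gens_subset_carrier: "triangular n H \<Longrightarrow> gens n H \<subseteq> carrier (Sylow2 n)"
  by (rule order_trans[OF _ unitri_subset_carrier]) (auto simp: gens_def intro: transv_in_unitri)

lemma unitri_eq_generate_Sylow2:
  "triangular n H \<Longrightarrow> substitution_closed n H \<Longrightarrow> unitri n H = generate (Sylow2 n) (gens n H)"
  by (simp add: unitri_eq_generate generate_Sylow2 gens_subset_carrier)

lemma subgroup_unitri:
  "triangular n H \<Longrightarrow> substitution_closed n H \<Longrightarrow> subgroup (unitri n H) (Sylow2 n)"
  by (simp add: unitri_eq_generate_Sylow2 group.generate_is_subgroup group_Sylow2 gens_subset_carrier)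

lemma Sylow2_apply:
  assumes "a \<in> carrier (Sylow2 n)" "b \<in> carrier (Sylow2 n)" "w \<in> letters n"
  shows "(a \<otimes>\<^bsub>Sylow2 n\<^esub> b) w = a (b w)"
proof -
  have "carrier (Sylow2 n) \<subseteq> Bij (letters n)"
    using subgroup.subset[OF subgroup_Sylow2] by (simp add: Sym_carrier)
  then show ?thesis using assms by (simp add: mult_Sylow2 Sym_mult compose_def subset_iff)
qed

text \<open>The monomial of \<open>{}\<close> is the constant 1, so these maps are the
  translations.\<close>

lemma transl_group_eq: "transl_group n = unitri n (\<lambda>_. {{}})"
proof -
  have "(\<lambda>i. rigid n i {}) ` {1..n} = gens n (\<lambda>_. {{}})"
    unfolding gens_def by (auto simp: rigid_eq_transv)
  moreover have "triangular n (\<lambda>_. {{}})" "substitution_closed n (\<lambda>_. {{}})"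
    by (simp_all add: triangular_def substitution_closed_def)
  ultimately show ?thesis unfolding transl_group_def by (simp add: unitri_eq_generate_Sylow2)
qed

text \<open>By \<open>act_inject\<close>, elements correspond to independent choices of a subset of
  each \<open>H k\<close>.\<close>

lemma card_unitri:
  assumes H: "triangular n H"
  shows "card (unitri n H) = 2 ^ (\<Sum>k\<in>{1..n}. card (H k))"
proof -
  let ?Q = "\<Pi>\<^sub>E k\<in>{1..n}. Pow (H k)"
  have "unitri n H = act n ` ?Q"
  proof (intro equalityI subsetI)
    fix g assume "g \<in> unitri n H"
    then obtain P where P: "\<And>k. k \<in> {1..n} \<Longrightarrow> P k \<subseteq> H k" "g = act n P" unfolding unitri_iff by blast
    have "act n P = act n (restrict P {1..n})" by (rule act_cong) simp
    moreover have "restrict P {1..n} \<in> ?Q" using P by auto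
    ultimately show "g \<in> act n ` ?Q" using P by blast
  next
    fix g assume "g \<in> act n ` ?Q"
    then show "g \<in> unitri n H" by (auto intro!: act_in_unitri)
  qed
  moreover have "inj_on (act n) ?Q"
  proof (rule inj_onI)
    fix P P' assume P: "P \<in> ?Q" "P' \<in> ?Q" and eq: "act n P = act n P'"
    have "triangular n P" "triangular n P'" using P by (auto intro!: triangular_subset[OF H])
    then have "P k = P' k" if "k \<in> {1..n}" for k using act_inject eq that by blast
    then show "P = P'" by (rule PiE_ext[OF P])
  qed
  ultimately have "card (unitri n H) = card ?Q" by (simp add: card_image)
  also have "\<dots> = (\<Prod>k\<in>{1..n}. 2 ^ card (H k))"
    using triangular_finite[OF H] by (simp add: card_PiE card_Pow)
  finally show ?thesis by (simp add: power_sum)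
qed

section \<open>Normalizers of saturated subgroups\<close>

text \<open>\<open>normalizer\<close> asks that the conjugate of \<open>U\<close> equal
  \<open>U\<close>, so conjugation by \<open>g\<close> and by its inverse both enter.\<close>

lemma (in group) normalizerI:
  assumes "g \<in> carrier G" "U \<subseteq> carrier G"
    and 1: "\<And>h. h \<in> U \<Longrightarrow> g \<otimes> h \<otimes> inv g \<in> U" and 2: "\<And>h. h \<in> U \<Longrightarrow> inv g \<otimes> h \<otimes> g \<in> U"
  shows "g \<in> normalizer G U"
proof -
  have "g <# U #> inv g = U"
  proof
    show "g <# U #> inv g \<subseteq> U" using 1 by (auto simp: l_coset_def r_coset_def)
    show "U \<subseteq> g <# U #> inv g"
    proof
      fix h assume h: "h \<in> U"
      then have "g \<otimes> (inv g \<otimes> h \<otimes> g) \<otimes> inv g = h"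
        using assms(1,2) by (simp add: m_assoc subset_iff) (simp add: inv_solve_left' flip: m_assoc)
      then show "h \<in> g <# U #> inv g"
        using 2[OF h] by (force simp: l_coset_def r_coset_def)
    qed
  qed
  then show ?thesis using assms(1,2) by (simp add: normalizer_def stabilizer_def)
qed

lemma (in group) normalizer_conj:
  assumes U: "U \<subseteq> carrier G" and g: "g \<in> normalizer G U" and h: "h \<in> U"
  shows "g \<otimes> h \<otimes> inv g \<in> U"
proof -
  have "g <# U #> inv g = U" using g U by (simp add: normalizer_def stabilizer_def)
  then show ?thesis using h by (auto simp: l_coset_def r_coset_def)
qed

lemma (in group) normalizer_carrier: "g \<in> normalizer G U \<Longrightarrow> g \<in> carrier G"
  by (simp add: normalizer_def stabilizer_def)

lemma (in group) conj_generate: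
  assumes e: "e \<in> carrier G" and S: "S \<subseteq> carrier G"
    and conj: "\<And>s. s \<in> S \<Longrightarrow> e \<otimes> s \<otimes> inv e \<in> generate G S" and h: "h \<in> generate G S"
  shows "e \<otimes> h \<otimes> inv e \<in> generate G S"
  using h
proof (induction rule: generate.induct)
  case one
  then show ?case using e by (simp add: generate.one)
next
  case (incl s)
  then show ?case by (rule conj)
next
  case (inv s)
  then have "s \<in> carrier G" using S by blast
  then have "e \<otimes> inv s \<otimes> inv e = inv (e \<otimes> s \<otimes> inv e)"
    using e by (simp add: inv_mult_group m_assoc)
  then show ?case using generate_m_inv_closed[OF S conj[OF inv]] by simp
next
  case (eng h1 h2)
  then have "h1 \<in> carrier G" "h2 \<in> carrier G" using generate_in_carrier[OF S] by auto
  then have "e \<otimes> (h1 \<otimes> h2) \<otimes> inv e = (e \<otimes> h1 \<otimes> inv e) \<otimes> (e \<otimes> h2 \<otimes> inv e)"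
    using e by (simp add: m_assoc) (simp flip: m_assoc)
  then show ?case using generate.eng[OF eng.IH] by simp
qed

text \<open>The two implications mirror the nontrivial cases of
  \<open>commutator_transv_cases\<close>: the commutators of \<open>transv n k {I}\<close> with the
  generators in \<open>gens n H\<close> are to be trivial or again such generators.\<close>

definition norm_family :: "nat \<Rightarrow> (nat \<Rightarrow> nat set set) \<Rightarrow> nat \<Rightarrow> nat set set" where
  "norm_family n H k = {I. I \<subseteq> {1..<k} \<and> (\<forall>j\<in>{1..n}. \<forall>J\<in>H j.
     (j \<in> I \<longrightarrow> (I - {j}) \<union> J \<in> H k) \<and> (k \<in> J \<longrightarrow> (J - {k}) \<union> I \<in> H j))}"

text \<open>The family of the translation group satisfies these conditions and
  \<open>norm_family\<close> preserves them, so they hold along the whole chain. The last one says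
  that the translations lie in the group.\<close>

locale admissible_family =
  fixes n :: nat and H :: "nat \<Rightarrow> nat set set"
  assumes tri: "triangular n H" and subst: "substitution_closed n H"
    and empty_in: "\<And>k. k \<in> {1..n} \<Longrightarrow> {} \<in> H k"
begin

text \<open>Substituting the constant monomial \<open>{}\<close> for a variable deletes it; the
  elements of \<open>I - J\<close> are deleted one at a time.\<close>

lemma down_closed:
  assumes k: "k \<in> {1..n}" and I: "I \<in> H k" and sub: "J \<subseteq> I"
  shows "J \<in> H k"
proof -
  have "finite (I - J)" using triangular_finite_mem[OF tri k I] by simp
  moreover have "I - D \<in> H k" if "finite D" "D \<subseteq> I" for D
    using that
  proof (induction D rule: finite_induct)
    case (insert d D)
    then have "d \<in> I - D" "d \<in> {1..n}" using triangularD[OF tri k I] k by auto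
    then have "(I - D - {d}) \<union> {} \<in> H k"
      using insert by (intro substitution_closedD[OF subst k] empty_in) auto
    moreover have "(I - D - {d}) \<union> {} = I - insert d D" by auto
    ultimately show ?case by simp
  qed (simp add: I)
  ultimately have "I - (I - J) \<in> H k" by blast
  moreover have "I - (I - J) = J" using sub by auto
  ultimately show ?thesis by simp
qed

lemma fin: "k \<in> {1..n} \<Longrightarrow> finite (H k)"
  by (rule triangular_finite[OF tri])

lemma sub: "k \<in> {1..n} \<Longrightarrow> H k \<subseteq> Pow {1..n}"
  by (rule triangular_Pow[OF tri])

abbreviation "U \<equiv> unitri n H"

lemma U_carrier: "U \<subseteq> carrier (Sylow2 n)"
  by (rule unitri_subset_carrier[OF tri])

text \<open>For involutions, the conjugate of a generator is its commutator with the conjugating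
  element times the generator. The commutators lie in \<open>U\<close> by the definition of
  \<open>norm_family\<close>, and \<open>conj_generate\<close> passes from generators to all of
  \<open>U\<close>.\<close>

lemma norm_gens:
  assumes k: "k \<in> {1..n}" and I: "I \<in> norm_family n H k"
  shows "transv n k {I} \<in> normalizer (Sylow2 n) U"
proof -
  interpret group "Sylow2 n" by (rule group_Sylow2)
  let ?e = "transv n k {I}"
  have Ik: "I \<subseteq> {1..<k}" using I by (simp add: norm_family_def)
  have e: "?e \<in> carrier (Sylow2 n)" using rigid_eq_transv_aux[OF k Ik] by blast
  have inv_e: "inv\<^bsub>Sylow2 n\<^esub> ?e = ?e" using Ik by (simp add: inv_Sylow2[OF e] transv_inv[OF k])
  have "?e \<otimes>\<^bsub>Sylow2 n\<^esub> s \<otimes>\<^bsub>Sylow2 n\<^esub> inv\<^bsub>Sylow2 n\<^esub> ?e \<in> U" if s: "s \<in> gens n H" for s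
  proof -
    obtain j J where j: "j \<in> {1..n}" and J: "J \<in> H j" and seq: "s = transv n j {J}"
      using s unfolding gens_def by blast
    have Jj: "J \<subseteq> {1..<j}" using triangularD[OF tri j J] .
    have sU: "s \<in> U" using J seq by (auto intro: transv_in_unitri)
    then have sc: "s \<in> carrier (Sylow2 n)" using U_carrier by blast
    have inv_s: "inv\<^bsub>Sylow2 n\<^esub> s = s" using Jj unfolding seq
      by (subst inv_Sylow2) (simp_all add: transv_inv[OF j] sc[unfolded seq])
    have "commutator (Sylow2 n) ?e s =
        (if j \<in> I then transv n k {(I - {j}) \<union> J}
         else if k \<in> J then transv n j {(J - {k}) \<union> I} else \<one>\<^bsub>Sylow2 n\<^esub>)"
      unfolding commutator_Sylow2[OF e sc] unfolding seq commutator_transv_cases[OF j k Ik Jj] one_Sylow2 ..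
    moreover have "j \<in> I \<Longrightarrow> transv n k {(I - {j}) \<union> J} \<in> U" "k \<in> J \<Longrightarrow> transv n j {(J - {k}) \<union> I} \<in> U"
      using I j J by (auto simp: norm_family_def intro!: transv_in_unitri)
    ultimately have "commutator (Sylow2 n) ?e s \<in> U"
      using subgroup.one_closed[OF subgroup_unitri[OF tri subst]] by simp
    then have "commutator (Sylow2 n) ?e s \<otimes>\<^bsub>Sylow2 n\<^esub> inv\<^bsub>Sylow2 n\<^esub> s \<in> U"
      using subgroup.m_closed[OF subgroup_unitri[OF tri subst]] sU inv_s by simp
    moreover have "commutator (Sylow2 n) ?e s \<otimes>\<^bsub>Sylow2 n\<^esub> inv\<^bsub>Sylow2 n\<^esub> s = inv\<^bsub>Sylow2 n\<^esub> ?e \<otimes>\<^bsub>Sylow2 n\<^esub> inv\<^bsub>Sylow2 n\<^esub> s \<otimes>\<^bsub>Sylow2 n\<^esub> ?e"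
      using e sc by (simp add: commutator_def m_assoc)
    ultimately show ?thesis by (simp add: inv_e inv_s)
  qed
  then have "?e \<otimes>\<^bsub>Sylow2 n\<^esub> h \<otimes>\<^bsub>Sylow2 n\<^esub> inv\<^bsub>Sylow2 n\<^esub> ?e \<in> U" if "h \<in> U" for h
    using conj_generate[OF e gens_subset_carrier[OF tri]] that
    unfolding unitri_eq_generate_Sylow2[OF tri subst] by blast
  then show ?thesis by (intro normalizerI e U_carrier) (simp_all add: inv_e)
qed

end

text \<open>An arbitrary element of the normalizer is fixed together with its polynomials; the goal
  is \<open>P_norm\<close>.\<close>

locale normalizing = admissible_family +
  fixes g :: perm2 and P :: "nat \<Rightarrow> nat set set"
  assumes g_norm: "g \<in> normalizer (Sylow2 n) U"
    and P_tri: "triangular n P" and g_act: "g = act n P"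
begin

lemma g_carrier: "g \<in> carrier (Sylow2 n)"
  by (rule group.normalizer_carrier[OF group_Sylow2 g_norm])

lemma g_letters: "w \<in> letters n \<Longrightarrow> g w \<in> letters n"
  unfolding g_act by (rule act_in_letters)

lemma P_below: "k \<in> {1..n} \<Longrightarrow> P k \<subseteq> Pow {1..<k}"
  using P_tri unfolding triangular_def by blast

text \<open>This and \<open>left_conj\<close> express conjugation as an exchange rule free of
  inverses, so that coordinates can be compared letter by letter.\<close>

lemma right_conj:
  assumes h: "h \<in> U"
  obtains h' where "h' \<in> U" "\<And>w. w \<in> letters n \<Longrightarrow> g (h w) = h' (g w)"
proof -
  interpret group "Sylow2 n" by (rule group_Sylow2)
  let ?h' = "g \<otimes>\<^bsub>Sylow2 n\<^esub> h \<otimes>\<^bsub>Sylow2 n\<^esub> inv\<^bsub>Sylow2 n\<^esub> g"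
  have h': "?h' \<in> U" by (rule normalizer_conj[OF U_carrier g_norm h])
  have c: "h \<in> carrier (Sylow2 n)" "?h' \<in> carrier (Sylow2 n)" using h h' U_carrier by blast+
  have "?h' \<otimes>\<^bsub>Sylow2 n\<^esub> g = g \<otimes>\<^bsub>Sylow2 n\<^esub> h" using g_carrier c(1) by (simp add: m_assoc)
  then have "g (h w) = ?h' (g w)" if "w \<in> letters n" for w
    using Sylow2_apply[OF c(2) g_carrier that] Sylow2_apply[OF g_carrier c(1) that] by simp
  then show thesis using that h' by blast
qed

lemma left_conj:
  assumes h: "h \<in> U"
  obtains h' where "h' \<in> U" "\<And>w. w \<in> letters n \<Longrightarrow> g (h' w) = h (g w)"
proof -
  interpret group "Sylow2 n" by (rule group_Sylow2)
  have "inv\<^bsub>Sylow2 n\<^esub> g \<in> normalizer (Sylow2 n) U"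
    using subgroup.m_inv_closed[OF normalizer_imp_subgroup[OF U_carrier] g_norm] .
  then have h': "inv\<^bsub>Sylow2 n\<^esub> g \<otimes>\<^bsub>Sylow2 n\<^esub> h \<otimes>\<^bsub>Sylow2 n\<^esub> g \<in> U" (is "?h' \<in> U")
    using normalizer_conj[OF U_carrier _ h] g_carrier by force
  have c: "h \<in> carrier (Sylow2 n)" "?h' \<in> carrier (Sylow2 n)" using h h' U_carrier by blast+
  have "g \<otimes>\<^bsub>Sylow2 n\<^esub> ?h' = h \<otimes>\<^bsub>Sylow2 n\<^esub> g" using g_carrier c(1) by (simp flip: m_assoc)
  then have "g (?h' w) = h (g w)" if "w \<in> letters n" for w
    using Sylow2_apply[OF g_carrier c(2) that] Sylow2_apply[OF c(1) g_carrier that] by simp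
  then show thesis using that h' by blast
qed

text \<open>Conjugating by \<open>g\<close> the transvection that adds \<open>p\<close> to
  coordinate \<open>k\<close> gives a member of \<open>U\<close> whose polynomial at
  \<open>k\<close> is \<open>p\<close> composed with \<open>g\<close>.\<close>

lemma spanned_g:
  assumes k: "k \<in> {1..n}" and p: "p \<in> spanned n (H k)"
  shows "(\<lambda>w. p (g w)) \<in> spanned n (H k)"
proof -
  obtain S where S: "S \<subseteq> H k" "\<And>w. w \<in> letters n \<Longrightarrow> p w = pol S w"
    using p by (auto simp: spanned_def)
  let ?h = "transv n k S"
  have hU: "?h \<in> U" by (rule transv_in_unitri) (rule S(1))
  obtain h' where h': "h' \<in> U" and eq: "\<And>w. w \<in> letters n \<Longrightarrow> g (h' w) = ?h (g w)"
    using left_conj[OF hU] by blast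
  have "h' w k + w k = p (g w)" if w: "w \<in> letters n" for w
  proof -
    have h'w: "h' w \<in> letters n" by (rule unitri_maps[OF h' w])
    have h: "?h (g w) = (g w)(k := g w k + pol S (g w))" by (rule transv_apply[OF g_letters[OF w] k])
    \<comment> \<open>Below \<open>k\<close> the letters \<open>g (h' w)\<close> and
      \<open>g w\<close> agree; as \<open>g\<close> is unitriangular, induction on the coordinate
      shows that \<open>h' w\<close> and \<open>w\<close> agree there too.\<close>
    have low: "h' w i = w i" if "1 \<le> i" "i < k" for i
      using that
    proof (induction i rule: less_induct)
      case (less i)
      then have i: "i \<in> {1..n}" using k by auto
      have "pol (P i) (h' w) = pol (P i) w"
        using less by (intro pol_below_cong[OF P_below[OF i]]) auto
      moreover have "g (h' w) i = g w i" using eq[OF w] h less.prems by simp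
      ultimately show ?case unfolding g_act act_coord[OF h'w i] act_coord[OF w i] by simp
    qed
    have "pol (P k) (h' w) = pol (P k) w"
      by (intro pol_below_cong[OF P_below[OF k]] low)
    moreover have "g (h' w) k = g w k + pol S (g w)" using eq[OF w] h by simp
    moreover have "g (h' w) k = h' w k + pol (P k) (h' w)" "g w k = w k + pol (P k) w"
      unfolding g_act by (rule act_coord[OF h'w k], rule act_coord[OF w k])
    moreover have "p (g w) = pol S (g w)" using S(2) g_letters[OF w] by blast
    ultimately have "h' w k + pol (P k) w = (w k + p (g w)) + pol (P k) w" by (simp add: ac_simps)
    then show ?thesis by (simp add: ac_simps)
  qed
  moreover have "(\<lambda>w. h' w k + w k) \<in> spanned n (H k)" using h' k unfolding unitri_def by blast
  ultimately show ?thesis by (simp cong: spanned_cong)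
qed

text \<open>Comparing coordinate \<open>k\<close> in the exchange rule expresses the difference as
  the polynomial of \<open>h'\<close> at \<open>k\<close> composed with \<open>g\<close>, to which
  \<open>spanned_g\<close> applies. For \<open>k = j\<close> the difference vanishes, because the
  polynomial at \<open>j\<close> does not involve coordinate \<open>j\<close>.\<close>

lemma pol_shift:
  assumes jk: "j \<in> {1..n}" "k \<in> {1..n}" and J: "J \<in> H j"
  shows "(\<lambda>w. pol (P k) (transv n j {J} w) + pol (P k) w) \<in> spanned n (H k)"
proof (cases "k = j")
  case True
  have "pol (P j) (transv n j {J} w) + pol (P j) w = 0" if w: "w \<in> letters n" for w
  proof -
    have "pol (P j) (transv n j {J} w) = pol (P j) w"
      unfolding transv_apply[OF w jk(1)] by (rule pol_below_cong[OF P_below[OF jk(1)]]) simp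
    then show ?thesis by simp
  qed
  then show ?thesis using True zero_in_spanned by (simp cong: spanned_cong)
next
  case False
  have hU: "transv n j {J} \<in> U" using J by (intro transv_in_unitri) simp
  then obtain h' where h': "h' \<in> U" and eq: "\<And>w. w \<in> letters n \<Longrightarrow> g (transv n j {J} w) = h' (g w)"
    using right_conj by blast
  have "pol (P k) (transv n j {J} w) + pol (P k) w = h' (g w) k + g w k" if w: "w \<in> letters n" for w
  proof -
    have "transv n j {J} w k = w k" using False by (simp add: transv_apply[OF w jk(1)])
    moreover have "g (transv n j {J} w) k = transv n j {J} w k + pol (P k) (transv n j {J} w)"
      unfolding g_act by (rule act_coord[OF transv_in_letters[OF w] jk(2)])
    ultimately have "h' (g w) k = w k + pol (P k) (transv n j {J} w)" using eq[OF w] by simp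
    moreover have "g w k = w k + pol (P k) w" unfolding g_act by (rule act_coord[OF w jk(2)])
    ultimately show ?thesis by (simp add: ac_simps)
  qed
  moreover have "(\<lambda>w. h' (g w) k + g w k) \<in> spanned n (H k)"
    by (rule spanned_g[OF jk(2), of "\<lambda>w. h' w k + w k"]) (use h' jk(2) in \<open>simp add: unitri_def\<close>)
  ultimately show ?thesis by (simp cong: spanned_cong)
qed

text \<open>By \<open>pol_transv\<close> the difference in \<open>pol_shift\<close> is a monomial
  times the partial derivative of the polynomial at \<open>k\<close>. As \<open>H j\<close> contains
  all subsets of \<open>J\<close>, there are enough multiples for
  \<open>union_in_if_multiples_spanned\<close>.\<close>

lemma subst_into_P:
  assumes j: "j \<in> {1..n}" and k: "k \<in> {1..n}" and I: "I \<in> P k" "j \<in> I" and J: "J \<in> H j"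
  shows "(I - {j}) \<union> J \<in> H k"
proof -
  let ?Q = "(\<lambda>I. I - {j}) ` {I\<in>P k. j \<in> I}"
  have Pk: "P k \<subseteq> Pow {1..n}" by (rule triangular_Pow[OF P_tri k])
  have "J \<subseteq> {1..<j}" "finite J" using triangularD[OF tri j J] triangular_finite_mem[OF tri j J] .
  then have "J \<subseteq> {1..n}" using j by auto
  moreover have "(\<lambda>w. sqmon J' w * pol ?Q w) \<in> spanned n (H k)" if J': "J' \<subseteq> J" for J'
  proof -
    have "finite J'" using J' \<open>finite J\<close> finite_subset by blast
    have "(\<lambda>w. pol (P k) (transv n j {J'} w) + pol (P k) w) \<in> spanned n (H k)"
      by (rule pol_shift[OF j k down_closed[OF j J J']])
    then show ?thesis by (simp add: pol_transv[OF Pk j \<open>finite J'\<close>] cong: spanned_cong)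
  qed
  ultimately show ?thesis
    using Pk I \<open>finite J\<close> by (intro union_in_if_multiples_spanned[of J n ?Q, OF _ _ _ sub[OF k]]) auto
qed

section \<open>Truncations and factors of the normalizing element\<close>

definition trunc :: "nat \<Rightarrow> perm2" where
  "trunc j = act n (\<lambda>k. if k \<le> j then P k else {})"

lemma trunc_letters: "w \<in> letters n \<Longrightarrow> trunc j w \<in> letters n"
  unfolding trunc_def by (rule act_in_letters)

lemma trunc_coord:
  "w \<in> letters n \<Longrightarrow> k \<in> {1..n} \<Longrightarrow> trunc j w k = (if k \<le> j then w k + pol (P k) w else w k)"
  unfolding trunc_def by (simp add: act_coord)

lemma trunc_n: "trunc n = g"
  unfolding trunc_def g_act by (rule act_cong) simp

lemma trunc_0: "w \<in> letters n \<Longrightarrow> trunc 0 w = w"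
  by (rule letters_eqI) (auto simp: trunc_letters trunc_coord)

lemma trunc_Suc:
  assumes "Suc j \<le> n" "w \<in> letters n"
  shows "trunc (Suc j) w = trunc j (transv n (Suc j) (P (Suc j)) w)"
  unfolding trunc_def act_step[OF P_tri assms(1)] using assms(2) by (simp add: compose_def)

text \<open>Downward induction from \<open>trunc n\<close>, which is \<open>g\<close>. In a monomial
  containing \<open>Suc j\<close>, passing from \<open>Suc j\<close> to \<open>j\<close> drops the
  polynomial added to that variable; what remains is the part of degree one in it, which
  \<open>spanned_restrict_coordinate\<close> extracts.\<close>

lemma spanned_trunc:
  assumes "j \<le> n" and k: "k \<in> {1..n}" and p: "p \<in> spanned n (H k)"
  shows "(\<lambda>w. p (trunc j w)) \<in> spanned n (H k)"
  using assms(1) p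
proof (induction arbitrary: p rule: inc_induct)
  case base
  then show ?case unfolding trunc_n by (rule spanned_g[OF k])
next
  case (step j)
  have j: "Suc j \<in> {1..n}" using step.hyps by simp
  show ?case
  proof (rule spanned_compose[OF fin[OF k] _ fin[OF k] trunc_letters step.prems])
    fix I assume I: "I \<in> H k"
    have finI: "finite I" by (rule triangular_finite_mem[OF tri k I])
    have In: "I \<subseteq> {1..n}" using I sub[OF k] by auto
    have F: "(\<lambda>w. sqmon I (trunc (Suc j) w)) \<in> spanned n (H k)"
      using step.IH sqmon_in_spanned[OF I] by blast
    show "(\<lambda>w. sqmon I (trunc j w)) \<in> spanned n (H k)"
    proof (cases "Suc j \<in> I")
      case False
      have "sqmon I (trunc j w) = sqmon I (trunc (Suc j) w)" if w: "w \<in> letters n" for w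
      proof (rule sqmon_cong)
        fix i assume "i \<in> I"
        then have "i \<in> {1..n}" "i \<noteq> Suc j" using In False by auto
        then show "trunc j w i = trunc (Suc j) w i" by (auto simp: trunc_coord[OF w])
      qed
      then show ?thesis using F by (simp cong: spanned_cong)
    next
      case True
      have "sqmon I (trunc j w) = sqmon I (trunc (Suc j) w) + sqmon I (trunc (Suc j) (w(Suc j := 1)))"
        if w: "w \<in> letters n" for w
      proof -
        let ?w = "w(Suc j := 1)"
        have w': "?w \<in> letters n" by (rule letters_update[OF w j])
        have P_eq: "pol (P i) ?w = pol (P i) w" if "i \<in> {1..n}" "i \<le> Suc j" for i
          by (rule pol_below_cong[OF P_below[OF that(1)]]) (use that in auto)
        \<comment> \<open>The other factors do not depend on coordinate \<open>Suc j\<close>: the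
          polynomials up to \<open>Suc j\<close> do not involve it, and later coordinates are left
          unchanged by the truncations.\<close>
        let ?R = "sqmon (I - {Suc j}) (trunc (Suc j) w)"
        have R: "sqmon (I - {Suc j}) (trunc j w) = ?R" "sqmon (I - {Suc j}) (trunc (Suc j) ?w) = ?R"
        proof -
          have "trunc j w i = trunc (Suc j) w i \<and> trunc (Suc j) ?w i = trunc (Suc j) w i" if "i \<in> I - {Suc j}" for i
          proof -
            have "i \<in> {1..n}" "i \<noteq> Suc j" using that In by auto
            then show ?thesis by (auto simp: trunc_coord[OF w] trunc_coord[OF w'] P_eq)
          qed
          then show "sqmon (I - {Suc j}) (trunc j w) = ?R" "sqmon (I - {Suc j}) (trunc (Suc j) ?w) = ?R"
            by (intro sqmon_cong; blast)+
        qed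
        have c: "trunc j w (Suc j) = w (Suc j)"
          "trunc (Suc j) w (Suc j) = w (Suc j) + pol (P (Suc j)) w"
          "trunc (Suc j) ?w (Suc j) = 1 + pol (P (Suc j)) w"
          using j by (simp_all add: trunc_coord[OF w] trunc_coord[OF w'] P_eq)
        \<comment> \<open>Here \<open>a\<close> is the coordinate, \<open>q\<close> the polynomial
          added to it and \<open>r\<close> the product of the other factors; at the value 1 the
          factor becomes \<open>q\<close>, which cancels the unwanted \<open>q * r\<close>.\<close>
        have "(a + 1) * r = (a + q + 1) * r + (1 + q + 1) * r" for a q r :: bit
          by (cases a; cases q; cases r) simp_all
        then show ?thesis unfolding sqmon_remove[OF finI True] R c .
      qed
      then show ?thesis using spanned_restrict_coordinate[OF sub[OF k] F j] by (simp cong: spanned_cong)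
    qed
  qed
qed

text \<open>The map \<open>\<psi>\<close> is the inverse of \<open>trunc j\<close>; it is carried along because the factor of \<open>g\<close> at
  \<open>Suc j\<close> is \<open>\<psi>\<close> after \<open>trunc (Suc j)\<close>.\<close>

lemma spanned_transv_P_aux:
  assumes "j \<le> n"
  shows "\<exists>\<psi>. (\<forall>w\<in>letters n. \<psi> w \<in> letters n \<and> \<psi> (trunc j w) = w) \<and>
     (\<forall>k\<in>{1..n}. \<forall>p\<in>spanned n (H k). (\<lambda>w. p (\<psi> w)) \<in> spanned n (H k) \<and>
        (\<forall>i\<in>{1..j}. (\<lambda>w. p (transv n i (P i) w)) \<in> spanned n (H k)))"
  using assms
proof (induction j)
  case 0
  show ?case by (rule exI[of _ "\<lambda>w. w"]) (simp add: trunc_0)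
next
  case (Suc j)
  let ?e = "transv n (Suc j) (P (Suc j))"
  have j: "Suc j \<in> {1..n}" using Suc.prems by simp
  obtain \<psi> where \<psi>: "\<And>w. w \<in> letters n \<Longrightarrow> \<psi> w \<in> letters n" "\<And>w. w \<in> letters n \<Longrightarrow> \<psi> (trunc j w) = w"
    and inv: "\<And>k p. k \<in> {1..n} \<Longrightarrow> p \<in> spanned n (H k) \<Longrightarrow> (\<lambda>w. p (\<psi> w)) \<in> spanned n (H k)"
    and old: "\<And>k p i. k \<in> {1..n} \<Longrightarrow> p \<in> spanned n (H k) \<Longrightarrow> i \<in> {1..j} \<Longrightarrow>
      (\<lambda>w. p (transv n i (P i) w)) \<in> spanned n (H k)"
    using Suc.IH Suc.prems by (metis Suc_leD)
  have e: "(\<lambda>w. p (?e w)) \<in> spanned n (H k)" if k: "k \<in> {1..n}" and p: "p \<in> spanned n (H k)" for k p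
  proof -
    have "p (\<psi> (trunc (Suc j) w)) = p (?e w)" if "w \<in> letters n" for w
      by (simp only: trunc_Suc[OF Suc.prems that] \<psi>(2)[OF transv_in_letters[OF that]])
    moreover have "(\<lambda>w. p (\<psi> (trunc (Suc j) w))) \<in> spanned n (H k)"
      by (rule spanned_trunc[OF Suc.prems k inv[OF k p]])
    ultimately show ?thesis by (simp cong: spanned_cong)
  qed
  show ?case
  \<comment> \<open>As \<open>?e\<close> is an involution, applying it after the inverse of
    \<open>trunc j\<close> inverts \<open>trunc (Suc j)\<close>.\<close>
  proof (intro exI[of _ "\<lambda>w. ?e (\<psi> w)"] conjI ballI)
    fix w assume w: "w \<in> letters n"
    show "?e (\<psi> w) \<in> letters n" by (intro transv_in_letters \<psi> w)
    show "?e (\<psi> (trunc (Suc j) w)) = w"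
      unfolding trunc_Suc[OF Suc.prems w] \<psi>(2)[OF transv_in_letters[OF w]]
      by (rule transv_comp_self[OF j P_below[OF j] w])
  next
    fix k p assume kp: "k \<in> {1..n}" "p \<in> spanned n (H k)"
    show "(\<lambda>w. p (?e (\<psi> w))) \<in> spanned n (H k)"
      by (rule inv[OF kp(1) e[OF kp]])
    show "(\<lambda>w. p (transv n i (P i) w)) \<in> spanned n (H k)" if "i \<in> {1..Suc j}" for i
      using old[OF kp] e[OF kp] that by (cases "i = Suc j") auto
  qed
qed

lemma spanned_transv_P:
  "i \<in> {1..n} \<Longrightarrow> k \<in> {1..n} \<Longrightarrow> p \<in> spanned n (H k) \<Longrightarrow>
    (\<lambda>w. p (transv n i (P i) w)) \<in> spanned n (H k)"
  using spanned_transv_P_aux[of n] by blast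

text \<open>The factor of \<open>g\<close> at \<open>j\<close> maps the monomial of
  \<open>insert j J'\<close> to itself plus the monomial of \<open>J'\<close> times the polynomial
  at \<open>j\<close>. By \<open>down_closed\<close> this is available for every subset
  \<open>J'\<close> of \<open>J - {j}\<close>, as \<open>union_in_if_multiples_spanned\<close>
  demands.\<close>

lemma subst_of_P:
  assumes j: "j \<in> {1..n}" and k: "k \<in> {1..n}" and I: "I \<in> P j" and J: "J \<in> H k" "j \<in> J"
  shows "(J - {j}) \<union> I \<in> H k"
proof -
  have finJ: "finite J" by (rule triangular_finite_mem[OF tri k J(1)])
  have "(\<lambda>w. sqmon J' w * pol (P j) w) \<in> spanned n (H k)" if J': "J' \<subseteq> J - {j}" for J'
  proof -
    have fin': "finite (insert j J')" using J' finJ finite_subset by auto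
    have in_H: "insert j J' \<in> H k" using J' J by (intro down_closed[OF k J(1)]) auto
    have "sqmon (insert j J') (transv n j (P j) w) + sqmon (insert j J') w = sqmon J' w * pol (P j) w"
      if w: "w \<in> letters n" for w
    proof -
      have "insert j J' - {j} = J'" using J' by auto
      then show ?thesis by (simp add: sqmon_transv[OF w j fin'] ac_simps)
    qed
    moreover have "(\<lambda>w. sqmon (insert j J') (transv n j (P j) w) + sqmon (insert j J') w) \<in> spanned n (H k)"
      by (intro spanned_add[OF fin[OF k]] spanned_transv_P[OF j k] sqmon_in_spanned in_H)
    ultimately show ?thesis by (simp cong: spanned_cong)
  qed
  then have "I \<union> (J - {j}) \<in> H k"
    using finJ sub[OF k] J(1) I
    by (intro union_in_if_multiples_spanned[OF _ _ triangular_Pow[OF P_tri j] sub[OF k]]) auto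
  then show ?thesis by (simp add: Un_commute)
qed

lemma P_norm:
  assumes k: "k \<in> {1..n}"
  shows "P k \<subseteq> norm_family n H k"
  unfolding norm_family_def
proof (intro subsetI CollectI conjI ballI impI)
  fix I x assume I: "I \<in> P k"
  show "x \<in> {1..<k}" if "x \<in> I" using P_below[OF k] I that by blast
  fix j J assume "j \<in> {1..n}" "J \<in> H j"
  then show "(I - {j}) \<union> J \<in> H k" if "j \<in> I" by (intro subst_into_P k I that)
  show "(J - {k}) \<union> I \<in> H j" if "k \<in> J" by (rule subst_of_P) fact+
qed

end

section \<open>The normalizer as a saturated subgroup\<close>

context admissible_family
begin

lemma triangular_norm: "triangular n (norm_family n H)"
  unfolding triangular_def norm_family_def by blast

lemma normalizer_subset: "normalizer (Sylow2 n) U \<subseteq> unitri n (norm_family n H)"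
proof
  fix g assume g: "g \<in> normalizer (Sylow2 n) U"
  then have "g \<in> unitri n full_family"
    using group.normalizer_carrier[OF group_Sylow2] by (simp flip: carrier_Sylow2_eq_unitri)
  then obtain P where P: "\<And>k. k \<in> {1..n} \<Longrightarrow> P k \<subseteq> full_family k" and act: "g = act n P"
    unfolding unitri_iff by blast
  have "triangular n P" using triangular_subset[OF triangular_full P] by blast
  then interpret normalizing n H g P using g act by unfold_locales
  show "g \<in> unitri n (norm_family n H)" unfolding act by (rule act_in_unitri) (rule P_norm)
qed

lemma subgroup_normalizer: "subgroup (normalizer (Sylow2 n) U) (Sylow2 n)"
  by (rule group.normalizer_imp_subgroup[OF group_Sylow2 U_carrier])

text \<open>Closure is inherited from the normalizer, which is closed under commutators as a group.\<close>

lemma substitution_closed_norm: "substitution_closed n (norm_family n H)"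
  unfolding substitution_closed_def
proof (intro ballI)
  fix k I j J assume k: "k \<in> {1..n}" and I: "I \<in> norm_family n H k" and jI: "j \<in> I" and J: "J \<in> norm_family n H j"
  have Ik: "I \<subseteq> {1..<k}" using triangularD[OF triangular_norm k I] .
  then have j: "j \<in> {1..n}" "j < k" using jI k by auto
  have Jj: "J \<subseteq> {1..<j}" using triangularD[OF triangular_norm j(1) J] .
  let ?M = "(Sylow2 n)\<lparr>carrier := normalizer (Sylow2 n) U\<rparr>"
  have ab: "transv n k {I} \<in> normalizer (Sylow2 n) U" "transv n j {J} \<in> normalizer (Sylow2 n) U"
    by (rule norm_gens[OF k I], rule norm_gens[OF j(1) J])
  then have c: "transv n k {I} \<in> carrier (Sylow2 n)" "transv n j {J} \<in> carrier (Sylow2 n)"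
    using group.normalizer_carrier[OF group_Sylow2] by blast+
  have "commutator (Sylow2 n) (transv n k {I}) (transv n j {J}) \<in> normalizer (Sylow2 n) U"
    unfolding commutator_def using ab subgroup_normalizer
    by (intro subgroup.m_closed[OF subgroup_normalizer] subgroup.m_inv_closed[OF subgroup_normalizer])
  then have "transv n k {(I - {j}) \<union> J} \<in> unitri n (norm_family n H)"
    using normalizer_subset jI
    by (simp add: commutator_Sylow2[OF c] commutator_transv_cases[OF j(1) k Ik Jj] subset_iff)
  moreover have "(I - {j}) \<union> J \<subseteq> {1..<k}" using Ik Jj j by auto
  ultimately show "(I - {j}) \<union> J \<in> norm_family n H k"
    using transv_in_unitri_iff[OF triangular_norm k, of "{(I - {j}) \<union> J}"] by auto
qed

lemma family_subset_norm:
  assumes k: "k \<in> {1..n}"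
  shows "H k \<subseteq> norm_family n H k"
  unfolding norm_family_def
proof (intro subsetI CollectI conjI ballI impI)
  fix I x assume I: "I \<in> H k"
  show "x \<in> {1..<k}" if "x \<in> I" using triangularD[OF tri k I] that by blast
  fix j J assume "j \<in> {1..n}" "J \<in> H j"
  then show "(I - {j}) \<union> J \<in> H k" if "j \<in> I" by (intro substitution_closedD[OF subst k I that])
  show "(J - {k}) \<union> I \<in> H j" if "k \<in> J" by (rule substitution_closedD[OF subst]) fact+
qed

lemma admissible_norm: "admissible_family n (norm_family n H)"
proof
  show "{} \<in> norm_family n H k" if "k \<in> {1..n}" for k
    using family_subset_norm[OF that] empty_in[OF that] by blast
qed (rule triangular_norm substitution_closed_norm)+

lemma normalizer_unitri: "normalizer (Sylow2 n) U = unitri n (norm_family n H)"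
proof
  have "gens n (norm_family n H) \<subseteq> normalizer (Sylow2 n) U"
    using norm_gens unfolding gens_def by blast
  then show "unitri n (norm_family n H) \<subseteq> normalizer (Sylow2 n) U"
    unfolding unitri_eq_generate_Sylow2[OF triangular_norm substitution_closed_norm]
    by (rule group.generate_subgroup_incl[OF group_Sylow2 _ subgroup_normalizer])
qed (rule normalizer_subset)

end

section \<open>The chain of basis sets\<close>

text \<open>The common combinatorial form of the three chains, see
  \<open>normalizer_chain_eq\<close>, \<open>basis_chain_eq\<close> and
  \<open>idealizer_chain_eq\<close>.\<close>

primrec chain_family :: "nat \<Rightarrow> nat \<Rightarrow> nat \<Rightarrow> nat set set" where
  "chain_family n 0 = norm_family n (\<lambda>_. {{}})"
| "chain_family n (Suc i) = norm_family n (chain_family n i)"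

lemma admissible_transl: "admissible_family n (\<lambda>_. {{}})"
  by unfold_locales (simp_all add: triangular_def substitution_closed_def)

lemma admissible_chain: "admissible_family n (chain_family n i)"
  by (induction i) (simp_all add: admissible_transl admissible_family.admissible_norm)

lemma normalizer_chain_eq: "normalizer_chain n i = unitri n (chain_family n i)"
  by (induction i)
    (simp_all add: transl_group_eq admissible_transl admissible_chain admissible_family.normalizer_unitri)

definition chi :: "nat set \<Rightarrow> partition" where
  "chi I = (\<Sum>i\<in>I. Poly_Mapping.single i 1)"

lemma lookup_chi: "finite I \<Longrightarrow> Poly_Mapping.lookup (chi I) i = (if i \<in> I then 1 else 0)"
  by (simp add: chi_def lookup_sum lookup_single when_def)

lemma supp_chi: "finite I \<Longrightarrow> supp (chi I) = I"
  by (simp add: supp_def lookup_chi)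

lemma chi_empty: "chi {} = 0"
  by (simp add: chi_def)

lemma chi_inject: "finite I \<Longrightarrow> finite J \<Longrightarrow> chi I = chi J \<Longrightarrow> I = J"
  by (metis supp_chi)

lemma lookup_chi_le: "finite I \<Longrightarrow> Poly_Mapping.lookup (chi I) i \<le> 1"
  by (simp add: lookup_chi)

lemma atLeastLessThan_eq_atMost_pred: "{1..<k} = {1..k - (1::nat)}"
  by auto

lemma chi_partitions2:
  assumes "I \<subseteq> {1..<k}"
  shows "chi I \<in> partitions2 (k - 1)"
proof -
  have "finite I" using assms finite_subset by blast
  moreover have "I \<subseteq> {1..k - 1}" using assms unfolding atLeastLessThan_eq_atMost_pred .
  ultimately show ?thesis unfolding partitions2_def using lookup_chi_le by (simp add: supp_chi)
qed

lemma partitions2_chi: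
  assumes "\<Lambda> \<in> partitions2 (k - 1)"
  obtains I where "I \<subseteq> {1..<k}" "\<Lambda> = chi I"
proof
  have sub: "supp \<Lambda> \<subseteq> {1..k - 1}" and le: "\<And>i. Poly_Mapping.lookup \<Lambda> i \<le> 1"
    using assms by (auto simp: partitions2_def)
  show "supp \<Lambda> \<subseteq> {1..<k}" using sub unfolding atLeastLessThan_eq_atMost_pred .
  have "finite (supp \<Lambda>)" using sub finite_subset by blast
  moreover have "Poly_Mapping.lookup \<Lambda> i = (if i \<in> supp \<Lambda> then 1 else 0)" for i
    using le[of i] by (auto simp: supp_def)
  ultimately show "\<Lambda> = chi (supp \<Lambda>)" by (intro poly_mapping_eqI) (simp add: lookup_chi)
qed

lemma chi_add: "finite I \<Longrightarrow> finite J \<Longrightarrow> I \<inter> J = {} \<Longrightarrow> chi I + chi J = chi (I \<union> J)"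
  by (simp add: chi_def sum.union_disjoint)

lemma chi_minus: "finite I \<Longrightarrow> j \<in> I \<Longrightarrow> chi I - Poly_Mapping.single j 1 = chi (I - {j})"
  by (intro poly_mapping_eqI) (auto simp: lookup_minus lookup_chi lookup_single when_def)

section \<open>Derivatives, products and brackets of basis elements\<close>

lemma pderivative_chi:
  "finite I \<Longrightarrow> pderivative j (monomial (chi I)) = (if j \<in> I then monomial (chi (I - {j})) else 0)"
  by (simp add: pderivative_def monomial_def lookup_chi chi_minus[simplified])

lemma reduce_monomial_chi: "finite I \<Longrightarrow> reduce (monomial (chi I)) = monomial (chi I)"
  using lookup_chi_le by (intro poly_mapping_eqI) (auto simp: lookup_reduce monomial_def lookup_single when_def)

text \<open>A common variable would be squared and is removed by \<open>reduce\<close>, whereas the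
  product of monomial functions is always the monomial of the union.\<close>

lemma times_trunc_chi:
  assumes "finite I" "finite J"
  shows "times_trunc (monomial (chi I)) (monomial (chi J)) =
    (if I \<inter> J = {} then monomial (chi (I \<union> J)) else 0)"
proof -
  have eq: "monomial (chi I) * monomial (chi J) = monomial (chi I + chi J)"
    by (simp add: monomial_def mult_single)
  show ?thesis
  proof (cases "I \<inter> J = {}")
    case True
    then show ?thesis
      using assms by (simp add: times_trunc_def eq chi_add reduce_monomial_chi)
  next
    case False
    then obtain i where "i \<in> I" "i \<in> J" by blast
    then have "Poly_Mapping.lookup (chi I + chi J) i = 2" using assms by (simp add: lookup_add lookup_chi)
    then have nle: "\<not> (\<forall>i. Poly_Mapping.lookup (chi I + chi J) i \<le> 1)" by (metis one_less_numeral_iff semiring_norm(76) not_le)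
    have "Poly_Mapping.lookup (reduce (monomial (chi I + chi J))) \<Theta> = 0" for \<Theta>
      using nle by (cases "\<Theta> = chi I + chi J") (auto simp: lookup_reduce monomial_def lookup_single)
    then have "reduce (monomial (chi I + chi J)) = 0" by (intro poly_mapping_eqI) simp
    then show ?thesis using False by (simp add: times_trunc_def eq)
  qed
qed

lemma times_trunc_0 [simp]: "times_trunc 0 q = 0" "times_trunc p 0 = 0"
  by (simp_all add: times_trunc_def reduce_def)

lemma times_del_0 [simp]: "times_del 0 k = 0"
  by (simp add: times_del_def)

lemma times_del_monomial: "times_del (monomial \<Lambda>) k = basis_elem \<Lambda> k"
  by (simp add: times_del_def monomial_def basis_elem_def)

lemma uminus_lie: "- z = (z :: lie)"
proof (rule poly_mapping_eqI)
  show "Poly_Mapping.lookup (- z) a = Poly_Mapping.lookup z a" for a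
    by (cases "Poly_Mapping.lookup z a") simp_all
qed

text \<open>Of the two terms of the bracket at most one is nonzero, since \<open>j \<in> I\<close> forces \<open>j < k\<close> and
  \<open>k \<in> J\<close> forces \<open>k < j\<close>.\<close>

lemma basis_bracket_chi:
  assumes I: "I \<subseteq> {1..<k}" and J: "J \<subseteq> {1..<j}"
  shows "basis_bracket (chi I, k) (chi J, j) =
    (if j \<in> I \<and> (I - {j}) \<inter> J = {} then basis_elem (chi ((I - {j}) \<union> J)) k
     else if k \<in> J \<and> (J - {k}) \<inter> I = {} then basis_elem (chi ((J - {k}) \<union> I)) j else 0)"
proof -
  have fin: "finite I" "finite J" using I J finite_subset by blast+
  have "\<not> (j \<in> I \<and> k \<in> J)" using I J by fastforce
  then show ?thesis
    using fin by (auto simp: pderivative_chi times_trunc_chi times_del_monomial uminus_lie Un_commute Int_commute)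
qed

lemma basis_elem_inject: "basis_elem \<Lambda> k = basis_elem \<Theta> j \<longleftrightarrow> \<Lambda> = \<Theta> \<and> k = j"
proof
  assume "basis_elem \<Lambda> k = basis_elem \<Theta> j"
  then have "Poly_Mapping.keys (basis_elem \<Lambda> k) = Poly_Mapping.keys (basis_elem \<Theta> j)" by simp
  then show "\<Lambda> = \<Theta> \<and> k = j" by (simp add: basis_elem_def)
qed simp

lemma basis_elem_nonzero: "basis_elem \<Lambda> k \<noteq> 0"
proof
  assume "basis_elem \<Lambda> k = 0"
  then have "Poly_Mapping.keys (basis_elem \<Lambda> k) = {}" by simp
  then show False by (simp add: basis_elem_def)
qed

text \<open>Nonzero coefficients over \<open>bit\<close> equal 1, so the scalar factors
  disappear.\<close>

lemma bracket_eq_sum: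
  "bracket u v = (\<Sum>a\<in>Poly_Mapping.keys u. \<Sum>b\<in>Poly_Mapping.keys v. basis_bracket a b)"
proof -
  have "lie_scale (Poly_Mapping.lookup u a * Poly_Mapping.lookup v b) z = z"
    if "a \<in> Poly_Mapping.keys u" "b \<in> Poly_Mapping.keys v" for a b z
    using that by (intro poly_mapping_eqI) (simp add: lookup_lie_scale in_keys_iff)
  then show ?thesis unfolding bracket_def by (intro sum.cong refl) simp
qed

lemma bracket_basis_elem: "bracket (basis_elem \<Lambda> k) (basis_elem \<Theta> j) = basis_bracket (\<Lambda>, k) (\<Theta>, j)"
  unfolding bracket_eq_sum basis_elem_def by (simp del: basis_bracket.simps)

definition index_of :: "nat \<Rightarrow> (nat \<Rightarrow> nat set set) \<Rightarrow> (partition \<times> nat) set" where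
  "index_of n H = {(chi I, k) |k I. k \<in> {1..n} \<and> I \<in> H k}"

definition basis_of :: "nat \<Rightarrow> (nat \<Rightarrow> nat set set) \<Rightarrow> lie set" where
  "basis_of n H = (\<lambda>(\<Lambda>, k). basis_elem \<Lambda> k) ` index_of n H"

definition lie_span :: "(partition \<times> nat) set \<Rightarrow> lie set" where
  "lie_span A = {z. Poly_Mapping.keys z \<subseteq> A}"

lemma index_ofI: "k \<in> {1..n} \<Longrightarrow> I \<in> H k \<Longrightarrow> (chi I, k) \<in> index_of n H"
  unfolding index_of_def by blast

lemma chi_in_index_iff:
  assumes "triangular n H" "finite I"
  shows "(chi I, k) \<in> index_of n H \<longleftrightarrow> k \<in> {1..n} \<and> I \<in> H k"
proof
  assume "(chi I, k) \<in> index_of n H"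
  then obtain J where J: "k \<in> {1..n}" "J \<in> H k" "chi I = chi J" unfolding index_of_def by blast
  then have "I = J" by (intro chi_inject assms(2) triangular_finite_mem[OF assms(1)])
  then show "k \<in> {1..n} \<and> I \<in> H k" using J by simp
qed (blast intro: index_ofI)

lemma basis_ofE:
  assumes "b \<in> basis_of n H"
  obtains k I where "k \<in> {1..n}" "I \<in> H k" "b = basis_elem (chi I) k"
  using assms unfolding basis_of_def index_of_def by auto

lemma basis_elem_in_basis_of_iff: "basis_elem \<Lambda> k \<in> basis_of n H \<longleftrightarrow> (\<Lambda>, k) \<in> index_of n H"
  by (auto simp: basis_of_def basis_elem_inject)

lemma basis_index_eq: "basis_index n = index_of n full_family"
proof (intro equalityI subsetI)
  fix a assume "a \<in> basis_index n"
  then obtain \<Lambda> k where a: "a = (\<Lambda>, k)" "k \<in> {1..n}" "\<Lambda> \<in> partitions2 (k - 1)"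
    unfolding basis_index_def by auto
  then obtain I where "I \<subseteq> {1..<k}" "\<Lambda> = chi I" using partitions2_chi by blast
  then show "a \<in> index_of n full_family" using a by (auto simp: full_family_def intro!: index_ofI)
next
  fix a assume "a \<in> index_of n full_family"
  then obtain I k where "a = (chi I, k)" "k \<in> {1..n}" "I \<subseteq> {1..<k}"
    unfolding index_of_def full_family_def by blast
  then show "a \<in> basis_index n" using chi_partitions2 by (simp add: basis_index_def)
qed

lemma lie_basis_eq: "lie_basis n = basis_of n full_family"
  unfolding lie_basis_def basis_index_eq basis_of_def by auto

lemma del_set_eq: "del_set n = basis_of n (\<lambda>_. {{}})"
  unfolding del_set_def basis_of_def index_of_def by (auto simp: chi_empty image_iff)

lemma lie_carrier_eq: "lie_carrier n = lie_span (index_of n full_family)"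
  by (simp add: lie_carrier_def lie_span_def basis_index_eq)

context admissible_family
begin

text \<open>Bracket and commutator differ only when the monomials being multiplied overlap, and then
  the bracket vanishes. The forward direction therefore tests \<open>J - I\<close>, which lies in
  \<open>H j\<close> by \<open>down_closed\<close>: its bracket is nonzero and has the same union as
  index set.\<close>

lemma bracket_in_iff:
  assumes k: "k \<in> {1..n}" and I: "I \<subseteq> {1..<k}"
  shows "(\<forall>b\<in>index_of n H. basis_bracket (chi I, k) b \<in> basis_of n H \<union> {0}) \<longleftrightarrow> I \<in> norm_family n H k"
proof
  have finI: "finite I" using I finite_subset by blast
  assume *: "\<forall>b\<in>index_of n H. basis_bracket (chi I, k) b \<in> basis_of n H \<union> {0}"
  show "I \<in> norm_family n H k"
    unfolding norm_family_def
  proof (intro CollectI conjI ballI impI)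
    fix j J assume j: "j \<in> {1..n}" and J: "J \<in> H j"
    have Jj: "J - I \<subseteq> {1..<j}" using triangularD[OF tri j J] by blast
    have finJ: "finite J" by (rule triangular_finite_mem[OF tri j J])
    have "J - I \<in> H j" by (rule down_closed[OF j J]) blast
    then have br: "basis_bracket (chi I, k) (chi (J - I), j) \<in> basis_of n H \<union> {0}"
      using * index_ofI[OF j] by blast
    {
      assume jI: "j \<in> I"
      have "(I - {j}) \<inter> (J - I) = {}" by blast
      then have "basis_elem (chi ((I - {j}) \<union> (J - I))) k \<in> basis_of n H"
        using br jI basis_elem_nonzero unfolding basis_bracket_chi[OF I Jj] by auto
      \<comment> \<open>Discarding \<open>I\<close> from \<open>J\<close> would lose the index
        \<open>j\<close> if it belonged to \<open>J\<close>.\<close>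
      moreover have "j \<notin> J" using triangularD[OF tri j J] by auto
      then have "(I - {j}) \<union> (J - I) = (I - {j}) \<union> J" using jI by blast
      ultimately show "(I - {j}) \<union> J \<in> H k"
        using finI finJ by (simp add: basis_elem_in_basis_of_iff chi_in_index_iff[OF tri])
    next
      assume kJ: "k \<in> J"
      have kI: "k \<notin> I" using I by auto
      have "j \<notin> I" using I triangularD[OF tri j J] kJ by fastforce
      moreover have "k \<in> J - I" "(J - I - {k}) \<inter> I = {}" using kJ kI by blast+
      ultimately have "basis_elem (chi ((J - I - {k}) \<union> I)) j \<in> basis_of n H"
        using br basis_elem_nonzero unfolding basis_bracket_chi[OF I Jj] by auto
      moreover have "(J - I - {k}) \<union> I = (J - {k}) \<union> I" by blast
      ultimately show "(J - {k}) \<union> I \<in> H j"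
        using finI finJ by (simp add: basis_elem_in_basis_of_iff chi_in_index_iff[OF tri])
    }
  qed (rule I)
next
  assume N: "I \<in> norm_family n H k"
  show "\<forall>b\<in>index_of n H. basis_bracket (chi I, k) b \<in> basis_of n H \<union> {0}"
  proof
    fix b assume "b \<in> index_of n H"
    then obtain J j where j: "j \<in> {1..n}" and J: "J \<in> H j" and b: "b = (chi J, j)"
      unfolding index_of_def by blast
    have "j \<in> I \<longrightarrow> (I - {j}) \<union> J \<in> H k" "k \<in> J \<longrightarrow> (J - {k}) \<union> I \<in> H j"
      using N j J unfolding norm_family_def by blast+
    then show "basis_bracket (chi I, k) b \<in> basis_of n H \<union> {0}"
      unfolding b basis_bracket_chi[OF I triangularD[OF tri j J]]
      using index_ofI[OF k] index_ofI[OF j] by (auto simp: basis_elem_in_basis_of_iff)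
  qed
qed

lemma basis_idealizer_eq: "basis_idealizer n (basis_of n H) = basis_of n (norm_family n H)"
proof -
  have iff: "(\<forall>h\<in>basis_of n H. bracket (basis_elem (chi I) k) h \<in> basis_of n H \<union> {0}) \<longleftrightarrow>
      I \<in> norm_family n H k" if "k \<in> {1..n}" "I \<subseteq> {1..<k}" for I k
    using bracket_in_iff[OF that] unfolding basis_of_def
    by (simp add: bracket_basis_elem ball_simps split_beta del: basis_bracket.simps)
  show ?thesis
  proof (intro equalityI subsetI)
    fix b assume b: "b \<in> basis_idealizer n (basis_of n H)"
    then have "b \<in> basis_of n full_family" unfolding basis_idealizer_def lie_basis_eq by blast
    then obtain I k where "k \<in> {1..n}" "I \<in> full_family k" "b = basis_elem (chi I) k"
      by (rule basis_ofE)
    then have I: "k \<in> {1..n}" "I \<subseteq> {1..<k}" "b = basis_elem (chi I) k"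
      by (simp_all add: full_family_def)
    then have "I \<in> norm_family n H k" using b iff[OF I(1,2)] unfolding basis_idealizer_def by blast
    then show "b \<in> basis_of n (norm_family n H)"
      using I index_ofI by (simp add: basis_elem_in_basis_of_iff)
  next
    fix b assume "b \<in> basis_of n (norm_family n H)"
    then obtain I k where I: "k \<in> {1..n}" "I \<in> norm_family n H k" "b = basis_elem (chi I) k"
      by (rule basis_ofE)
    then have Ik: "I \<subseteq> {1..<k}" unfolding norm_family_def by blast
    then have "b \<in> lie_basis n"
      unfolding I(3) lie_basis_eq basis_elem_in_basis_of_iff using I(1)
      by (intro index_ofI) (simp_all add: full_family_def)
    then show "b \<in> basis_idealizer n (basis_of n H)"
      using iff[OF I(1) Ik] I(2,3) unfolding basis_idealizer_def by blast
  qed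
qed

end

lemma basis_chain_eq: "basis_chain n i = basis_of n (chain_family n i)"
  by (induction i)
    (simp_all add: del_set_eq admissible_transl admissible_chain admissible_family.basis_idealizer_eq)

lemma to_rigid_basis_of:
  assumes "triangular n H"
  shows "to_rigid n ` basis_of n H = gens n H"
proof -
  have "to_rigid n (basis_elem (chi I) k) = transv n k {I}" if "k \<in> {1..n}" "I \<in> H k" for I k
    using that triangularD[OF assms that] triangular_finite_mem[OF assms that]
    by (simp only: to_rigid_basis_elem supp_chi) (rule rigid_eq_transv)
  then show ?thesis unfolding basis_of_def index_of_def gens_def image_def by fastforce
qed

text \<open>The commutators are given by \<open>commutator_transv_cases\<close>, and substitution
  closure puts the resulting index sets back into the family.\<close>

lemma saturated_gens:
  assumes tri: "triangular n H" and subst: "substitution_closed n H"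
  shows "saturated n (gens n H)"
  unfolding saturated_def
proof (intro conjI ballI)
  interpret group "Sylow2 n" by (rule group_Sylow2)
  let ?G = "Sylow2 n"
  have gen: "\<exists>k I. k \<in> {1..n} \<and> I \<in> H k \<and> I \<subseteq> {1..<k} \<and> a = transv n k {I}" if "a \<in> gens n H" for a
    using that triangularD[OF tri] unfolding gens_def by blast
  show "gens n H \<subseteq> rigid_commutators n"
  proof
    fix a assume "a \<in> gens n H"
    then obtain k I where k: "k \<in> {1..n}" and I: "I \<subseteq> {1..<k}" and a: "a = transv n k {I}" using gen by blast
    have "I \<subseteq> {1..k - 1}" using I by force
    then show "a \<in> rigid_commutators n"
      unfolding rigid_commutators_def a using k rigid_eq_transv[OF k I, symmetric] by auto
  qed
  fix a b assume a: "a \<in> gens n H \<union> {\<one>\<^bsub>?G\<^esub>}" and b: "b \<in> gens n H \<union> {\<one>\<^bsub>?G\<^esub>}"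
  have c: "a \<in> carrier ?G" "b \<in> carrier ?G" using a b gens_subset_carrier[OF tri] by auto
  show "commutator ?G a b \<in> gens n H \<union> {\<one>\<^bsub>?G\<^esub>}"
  proof (cases "a = \<one>\<^bsub>?G\<^esub> \<or> b = \<one>\<^bsub>?G\<^esub>")
    case True
    then have "commutator ?G a b = \<one>\<^bsub>?G\<^esub>" using c by (auto simp: commutator_def)
    then show ?thesis by simp
  next
    case False
    then have "a \<in> gens n H" "b \<in> gens n H" using a b by auto
    then obtain k I j J where k: "k \<in> {1..n}" "I \<in> H k" "I \<subseteq> {1..<k}" "a = transv n k {I}"
      and j: "j \<in> {1..n}" "J \<in> H j" "J \<subseteq> {1..<j}" "b = transv n j {J}"
      using gen by meson
    have "commutator ?G a b = (if j \<in> I then transv n k {(I - {j}) \<union> J}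
       else if k \<in> J then transv n j {(J - {k}) \<union> I} else \<one>\<^bsub>?G\<^esub>)"
      unfolding commutator_Sylow2[OF c]
      unfolding k(4) j(4) commutator_transv_cases[OF j(1) k(1,3) j(3)] one_Sylow2 ..
    moreover have "j \<in> I \<Longrightarrow> transv n k {(I - {j}) \<union> J} \<in> gens n H"
      by (intro gensI k(1) substitution_closedD[OF subst k(1,2) _ j(2)])
    moreover have "k \<in> J \<Longrightarrow> transv n j {(J - {k}) \<union> I} \<in> gens n H"
      by (intro gensI j(1) substitution_closedD[OF subst j(1,2) _ k(2)])
    ultimately show ?thesis by simp
  qed
qed

section \<open>Idealizers and ranks\<close>

lemma lie_span_0: "0 \<in> lie_span A"
  by (simp add: lie_span_def)

lemma lie_span_add: "u \<in> lie_span A \<Longrightarrow> v \<in> lie_span A \<Longrightarrow> u + v \<in> lie_span A"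
  unfolding lie_span_def using Poly_Mapping.keys_add[of u v] by blast

lemma lie_span_sum: "(\<And>a. a \<in> S \<Longrightarrow> f a \<in> lie_span A) \<Longrightarrow> sum f S \<in> lie_span A"
  by (induction S rule: infinite_finite_induct) (simp_all add: lie_span_0 lie_span_add)

lemma lie_diff_eq_add: "u - v = u + (v :: lie)"
  using uminus_lie[of v] by (metis diff_conv_add_uminus)

lemma lie_span_scale: "u \<in> lie_span A \<Longrightarrow> lie_scale c u \<in> lie_span A"
  by (auto simp: lie_span_def in_keys_iff lookup_lie_scale)

lemma lie_span_iff: "u \<in> lie_span A \<longleftrightarrow> (\<forall>a. a \<notin> A \<longrightarrow> Poly_Mapping.lookup u a = 0)"
  by (auto simp: lie_span_def in_keys_iff)

lemma basis_elem_in_span: "(\<Lambda>, k) \<in> A \<Longrightarrow> basis_elem \<Lambda> k \<in> lie_span A"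
  by (simp add: lie_span_def basis_elem_def)

lemma lie_eq_sum: "z = (\<Sum>a\<in>Poly_Mapping.keys z. case a of (\<Lambda>, k) \<Rightarrow> basis_elem \<Lambda> k)"
proof (rule poly_mapping_eqI)
  fix b
  have "(\<Sum>a\<in>Poly_Mapping.keys z. Poly_Mapping.lookup (case a of (\<Lambda>, k) \<Rightarrow> basis_elem \<Lambda> k) b) =
      (\<Sum>a\<in>Poly_Mapping.keys z. if a = b then 1 else 0)"
    by (intro sum.cong refl) (auto simp: basis_elem_def lookup_single when_def)
  also have "\<dots> = Poly_Mapping.lookup z b"
    by (simp add: in_keys_iff)
  finally show "Poly_Mapping.lookup z b =
      Poly_Mapping.lookup (\<Sum>a\<in>Poly_Mapping.keys z. case a of (\<Lambda>, k) \<Rightarrow> basis_elem \<Lambda> k) b"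
    by (simp add: lookup_sum)
qed

lemma span_basis_of: "Modules.module.span lie_scale (basis_of n H) = lie_span (index_of n H)"
proof -
  interpret V: vector_space lie_scale by (rule vector_space_lie_scale)
  show ?thesis
  proof
    have "V.subspace (lie_span (index_of n H))"
      by (intro V.subspaceI lie_span_0 lie_span_add lie_span_scale)
    moreover have "basis_of n H \<subseteq> lie_span (index_of n H)"
      unfolding basis_of_def by (auto intro: basis_elem_in_span)
    ultimately show "V.span (basis_of n H) \<subseteq> lie_span (index_of n H)" by (intro V.span_minimal)
    show "lie_span (index_of n H) \<subseteq> V.span (basis_of n H)"
    proof
      fix z assume "z \<in> lie_span (index_of n H)"
      then have "(case a of (\<Lambda>, k) \<Rightarrow> basis_elem \<Lambda> k) \<in> basis_of n H" if "a \<in> Poly_Mapping.keys z" for a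
        using that unfolding lie_span_def basis_of_def by blast
      then show "z \<in> V.span (basis_of n H)"
        by (subst lie_eq_sum) (intro V.span_sum V.span_base)
    qed
  qed
qed

lemma basis_bracket_cases:
  assumes "I \<subseteq> {1..<k}" "J \<subseteq> {1..<j}"
  obtains "basis_bracket (chi I, k) (chi J, j) = 0"
  | \<Lambda> l where "basis_bracket (chi I, k) (chi J, j) = basis_elem \<Lambda> l"
proof -
  have "basis_bracket (chi I, k) (chi J, j) = 0 \<or>
      (\<exists>\<Lambda> l. basis_bracket (chi I, k) (chi J, j) = basis_elem \<Lambda> l)"
    unfolding basis_bracket_chi[OF assms] by auto
  then show thesis using that by blast
qed

text \<open>The position \<open>l\<close> decides which term of the bracket is present: it is
  \<open>k\<close>, different from \<open>j\<close>, in the first and \<open>j\<close> in the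
  second. In the first, disjointness recovers \<open>I\<close> from the union; in the second,
  \<open>k\<close> is the only element of \<open>J\<close> missing from the union, and disjointness
  again gives \<open>I\<close>.\<close>

lemma basis_bracket_inject:
  assumes I: "I \<subseteq> {1..<k}" and I': "I' \<subseteq> {1..<k'}" and J: "J \<subseteq> {1..<j}"
    and eq: "basis_bracket (chi I, k) (chi J, j) = basis_elem \<Lambda> l"
    and eq': "basis_bracket (chi I', k') (chi J, j) = basis_elem \<Lambda> l"
  shows "I = I' \<and> k = k'"
proof -
  have fin: "finite I" "finite I'" "finite J" using I I' J finite_subset by blast+
  have r: "(j \<in> I \<and> (I - {j}) \<inter> J = {} \<and> \<Lambda> = chi ((I - {j}) \<union> J) \<and> l = k) \<or>
      (k \<in> J \<and> (J - {k}) \<inter> I = {} \<and> \<Lambda> = chi ((J - {k}) \<union> I) \<and> l = j)"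
    using eq unfolding basis_bracket_chi[OF I J]
    by (auto simp: basis_elem_inject basis_elem_nonzero[symmetric] split: if_splits)
  have r': "(j \<in> I' \<and> (I' - {j}) \<inter> J = {} \<and> \<Lambda> = chi ((I' - {j}) \<union> J) \<and> l = k') \<or>
      (k' \<in> J \<and> (J - {k'}) \<inter> I' = {} \<and> \<Lambda> = chi ((J - {k'}) \<union> I') \<and> l = j)"
    using eq' unfolding basis_bracket_chi[OF I' J]
    by (auto simp: basis_elem_inject basis_elem_nonzero[symmetric] split: if_splits)
  have jI: "j \<in> I \<Longrightarrow> j \<noteq> k" "j \<in> I' \<Longrightarrow> j \<noteq> k'" and kI: "k \<notin> I" "k' \<notin> I'" using I I' by auto
  from r r' show ?thesis
  proof (elim disjE conjE)
    assume a: "j \<in> I" "(I - {j}) \<inter> J = {}" "\<Lambda> = chi ((I - {j}) \<union> J)" "l = k"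
      "j \<in> I'" "(I' - {j}) \<inter> J = {}" "\<Lambda> = chi ((I' - {j}) \<union> J)" "l = k'"
    have "(I - {j}) \<union> J = (I' - {j}) \<union> J" by (rule chi_inject) (use fin a in auto)
    then have "I - {j} = I' - {j}" using a(2,6) by blast
    then show ?thesis using a by blast
  next
    assume a: "k \<in> J" "(J - {k}) \<inter> I = {}" "\<Lambda> = chi ((J - {k}) \<union> I)"
      "k' \<in> J" "(J - {k'}) \<inter> I' = {}" "\<Lambda> = chi ((J - {k'}) \<union> I')"
    have e: "(J - {k}) \<union> I = (J - {k'}) \<union> I'" by (rule chi_inject) (use fin a in auto)
    have "k = k'" using e a(1) kI(1) by blast
    moreover from this have "I = I'" using e a(2,5) by blast
    ultimately show ?thesis by simp
  qed (use jI in auto)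
qed

context admissible_family
begin

text \<open>By \<open>basis_bracket_inject\<close> nothing cancels in the bracket of
  \<open>z\<close> with a basis element, so the basis elements occurring in \<open>z\<close> can be
  tested separately with \<open>bracket_in_iff\<close>.\<close>

lemma idealizer_eq: "idealizer n (lie_span (index_of n H)) = lie_span (index_of n (norm_family n H))"
proof (intro equalityI subsetI)
  fix z assume z: "z \<in> idealizer n (lie_span (index_of n H))"
  then have keys: "Poly_Mapping.keys z \<subseteq> index_of n full_family"
    and br: "\<And>h. h \<in> lie_span (index_of n H) \<Longrightarrow> bracket z h \<in> lie_span (index_of n H)"
    by (auto simp: idealizer_def lie_carrier_eq lie_span_def)
  have keyE: "\<exists>k I. k \<in> {1..n} \<and> I \<subseteq> {1..<k} \<and> a = (chi I, k)" if "a \<in> Poly_Mapping.keys z" for a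
    using that keys unfolding index_of_def full_family_def by blast
  have "a \<in> index_of n (norm_family n H)" if a: "a \<in> Poly_Mapping.keys z" for a
  proof -
    obtain k I where k: "k \<in> {1..n}" and I: "I \<subseteq> {1..<k}" and a_eq: "a = (chi I, k)" using keyE[OF a] by blast
    have "basis_bracket a b \<in> basis_of n H \<union> {0}" if b: "b \<in> index_of n H" for b
    proof -
      obtain j J where j: "j \<in> {1..n}" and J: "J \<in> H j" and b_eq: "b = (chi J, j)"
        using b unfolding index_of_def by blast
      have Jj: "J \<subseteq> {1..<j}" by (rule triangularD[OF tri j J])
      show ?thesis
      proof (rule basis_bracket_cases[OF I Jj])
        fix \<Lambda> l assume c: "basis_bracket (chi I, k) (chi J, j) = basis_elem \<Lambda> l"
        have "bracket z (basis_elem (chi J) j) \<in> lie_span (index_of n H)"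
          using b unfolding b_eq by (intro br basis_elem_in_span)
        moreover have "bracket z (basis_elem (chi J) j) = (\<Sum>a'\<in>Poly_Mapping.keys z. basis_bracket a' b)"
          unfolding bracket_eq_sum basis_elem_def b_eq by (simp del: basis_bracket.simps)
        \<comment> \<open>Only the summand at \<open>a\<close> contributes to this
          coefficient.\<close>
        moreover have "Poly_Mapping.lookup (\<Sum>a'\<in>Poly_Mapping.keys z. basis_bracket a' b) (\<Lambda>, l) = 1"
        proof -
          have "Poly_Mapping.lookup (basis_bracket a' b) (\<Lambda>, l) = (if a' = a then 1 else 0)"
            if a': "a' \<in> Poly_Mapping.keys z" for a'
          proof -
            obtain k' I' where I': "I' \<subseteq> {1..<k'}" and a'_eq: "a' = (chi I', k')" using keyE[OF a'] by blast
            show ?thesis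
            proof (cases "a' = a")
              case True
              then have "basis_bracket a' b = basis_elem \<Lambda> l" using c unfolding a_eq b_eq by simp
              then show ?thesis using True by (simp add: basis_elem_def)
            next
              case False
              show ?thesis
              proof (rule basis_bracket_cases[OF I' Jj])
                fix \<Theta> m assume d: "basis_bracket (chi I', k') (chi J, j) = basis_elem \<Theta> m"
                have "(\<Theta>, m) \<noteq> (\<Lambda>, l)"
                proof
                  assume "(\<Theta>, m) = (\<Lambda>, l)"
                  then have "basis_bracket (chi I', k') (chi J, j) = basis_elem \<Lambda> l" using d by (simp only: prod.inject)
                  from basis_bracket_inject[OF I I' Jj c this] show False using False unfolding a_eq a'_eq by blast
                qed
                then show ?thesis using False d unfolding a'_eq b_eq
                  by (simp add: basis_elem_def lookup_single del: basis_bracket.simps)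
              qed (use False a'_eq b_eq in \<open>simp del: basis_bracket.simps\<close>)
            qed
          qed
          then show ?thesis using a by (simp add: lookup_sum)
        qed
        ultimately have "(\<Lambda>, l) \<in> index_of n H" unfolding lie_span_iff by (metis zero_neq_one)
        then show ?thesis unfolding a_eq b_eq c by (simp add: basis_elem_in_basis_of_iff)
      qed (simp add: a_eq b_eq del: basis_bracket.simps)
    qed
    then have "I \<in> norm_family n H k" using bracket_in_iff[OF k I] unfolding a_eq by blast
    then show ?thesis unfolding a_eq by (rule index_ofI[OF k])
  qed
  then show "z \<in> lie_span (index_of n (norm_family n H))" unfolding lie_span_def by blast
next
  fix z assume z: "z \<in> lie_span (index_of n (norm_family n H))"
  have in_span: "basis_bracket a b \<in> lie_span (index_of n H)"
    if a_in: "a \<in> index_of n (norm_family n H)" and b_in: "b \<in> index_of n H" for a b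
  proof -
    obtain k I where k: "k \<in> {1..n}" and I: "I \<in> norm_family n H k" and a: "a = (chi I, k)"
      using a_in unfolding index_of_def by blast
    have "I \<subseteq> {1..<k}" using I unfolding norm_family_def by blast
    then have "basis_bracket a b \<in> basis_of n H \<union> {0}"
      using bracket_in_iff[OF k] I b_in unfolding a by blast
    then show ?thesis unfolding basis_of_def using basis_elem_in_span lie_span_0 by fastforce
  qed
  have "bracket z h \<in> lie_span (index_of n H)" if h: "h \<in> lie_span (index_of n H)" for h
    unfolding bracket_eq_sum using z h by (intro lie_span_sum in_span) (auto simp: lie_span_def)
  moreover have "index_of n (norm_family n H) \<subseteq> index_of n full_family"
    unfolding index_of_def norm_family_def full_family_def by blast
  then have "z \<in> lie_carrier n" using z unfolding lie_carrier_eq lie_span_def by blast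
  ultimately show "z \<in> idealizer n (lie_span (index_of n H))" unfolding idealizer_def by blast
qed

end

lemma idealizer_chain_eq: "idealizer_chain n i = lie_span (index_of n (chain_family n i))"
  by (induction i)
    (simp_all add: del_set_eq span_basis_of admissible_transl admissible_chain admissible_family.idealizer_eq)

section \<open>Cardinalities of index sets\<close>

lemma finite_index_of: "triangular n H \<Longrightarrow> finite (index_of n H)"
proof -
  assume H: "triangular n H"
  have "index_of n H = (\<Union>k\<in>{1..n}. (\<lambda>I. (chi I, k)) ` H k)" unfolding index_of_def by blast
  then show ?thesis using triangular_finite[OF H] by simp
qed

lemma card_index_of:
  assumes H: "triangular n H"
  shows "card (index_of n H) = (\<Sum>k\<in>{1..n}. card (H k))"
proof -
  have "index_of n H = (\<lambda>(k, I). (chi I, k)) ` (SIGMA k:{1..n}. H k)"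
    unfolding index_of_def by force
  moreover have "inj_on (\<lambda>(k, I). (chi I, k)) (SIGMA k:{1..n}. H k)"
  proof (rule inj_onI)
    fix x y assume x: "x \<in> (SIGMA k:{1..n}. H k)" and y: "y \<in> (SIGMA k:{1..n}. H k)"
      and eq: "(\<lambda>(k, I). (chi I, k)) x = (\<lambda>(k, I). (chi I, k)) y"
    obtain k I I' where x_eq: "x = (k, I)" and y_eq: "y = (k, I')" and chi: "chi I = chi I'"
      using eq by (cases x; cases y) auto
    have "k \<in> {1..n}" "I \<in> H k" "I' \<in> H k" using x y unfolding x_eq y_eq by blast+
    then have "I = I'" by (intro chi_inject[OF _ _ chi] triangular_finite_mem[OF H])
    then show "x = y" by (simp add: x_eq y_eq)
  qed
  ultimately have "card (index_of n H) = card (SIGMA k:{1..n}. H k)" by (simp add: card_image)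
  then show ?thesis using triangular_finite[OF H] by simp
qed

lemma index_of_mono: "(\<And>k. k \<in> {1..n} \<Longrightarrow> H k \<subseteq> H' k) \<Longrightarrow> index_of n H \<subseteq> index_of n H'"
  unfolding index_of_def by blast

lemma card_bit: "card (UNIV :: bit set) = 2"
proof -
  have "x \<in> {0, 1}" for x :: bit by (cases x) simp_all
  then have "(UNIV :: bit set) = {0, 1}" by blast
  moreover have "card {0, 1 :: bit} = 2" by (simp add: card_insert_if)
  ultimately show ?thesis by simp
qed

section \<open>Cosets and the quotient module\<close>

lemma lie_span_plus: "lie_span B + lie_span B = lie_span B"
proof (intro equalityI subsetI)
  fix u assume "u \<in> lie_span B"
  then show "u \<in> lie_span B + lie_span B" using set_plus_intro[OF _ lie_span_0[of B]] by fastforce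
qed (auto elim!: set_plus_elim intro: lie_span_add)

lemma coset_eq_iff: "u +o lie_span B = v +o lie_span B \<longleftrightarrow> u - v \<in> lie_span B"
proof
  assume "u +o lie_span B = v +o lie_span B"
  moreover have "u \<in> u +o lie_span B" using set_plus_intro2[OF lie_span_0, of u B] by simp
  ultimately show "u - v \<in> lie_span B" by (metis set_plus_imp_minus)
next
  assume d: "u - v \<in> lie_span B"
  have "u +o lie_span B = v +o ((u - v) +o lie_span B)" by (simp add: set_plus_rearrange2)
  also have "(u - v) +o lie_span B = lie_span B"
  proof (intro equalityI subsetI)
    fix w assume "w \<in> lie_span B"
    then have "w - (u - v) \<in> lie_span B" using d by (simp only: lie_diff_eq_add) (rule lie_span_add)
    then show "w \<in> (u - v) +o lie_span B" by (rule set_minus_imp_plus)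
  qed (use d in \<open>auto simp: elt_set_plus_def intro: lie_span_add\<close>)
  finally show "u +o lie_span B = v +o lie_span B" .
qed

lemma coset_add: "(u +o lie_span B) + (v +o lie_span B) = (u + v) +o lie_span B"
  by (simp add: set_plus_rearrange lie_span_plus)

text \<open>For \<open>c = 0\<close> the image of the coset is only \<open>{0}\<close>, and the
  added \<open>lie_span B\<close> restores a full coset; for \<open>c = 1\<close> adding it changes
  nothing.\<close>

lemma coset_scale: "lie_scale c ` (u +o lie_span B) + lie_span B = lie_scale c u +o lie_span B"
proof (cases c)
  case zero
  have z: "lie_scale 0 v = 0" for v by (intro poly_mapping_eqI) (simp add: lookup_lie_scale)
  have "u \<in> u +o lie_span B" using set_plus_intro2[OF lie_span_0, of u B] by simp
  then have "lie_scale 0 ` (u +o lie_span B) = {0}" using z by auto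
  then show ?thesis using zero by (simp add: z)
next
  case one
  have "lie_scale 1 v = v" for v by (intro poly_mapping_eqI) (simp add: lookup_lie_scale)
  then show ?thesis using one lie_span_plus[of B] by (simp add: set_plus_rearrange3)
qed

lemma abelian_monoid_quotient: "abelian_monoid (quotient_module (lie_span A) (lie_span B))"
proof (rule abelian_monoidI)
  let ?M = "quotient_module (lie_span A) (lie_span B)"
  show "x \<oplus>\<^bsub>?M\<^esub> y \<in> carrier ?M" if "x \<in> carrier ?M" "y \<in> carrier ?M" for x y
    using that by (auto simp: quotient_module_def coset_add intro!: imageI lie_span_add)
  have "(0 :: lie) +o lie_span B \<in> (\<lambda>a. a +o lie_span B) ` lie_span A" by (intro imageI lie_span_0)
  then show "\<zero>\<^bsub>?M\<^esub> \<in> carrier ?M" by (simp add: quotient_module_def)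
  show "\<zero>\<^bsub>?M\<^esub> \<oplus>\<^bsub>?M\<^esub> x = x" if "x \<in> carrier ?M" for x
    using that coset_add[of 0 B] by (auto simp: quotient_module_def)
  show "x \<oplus>\<^bsub>?M\<^esub> y \<oplus>\<^bsub>?M\<^esub> z = x \<oplus>\<^bsub>?M\<^esub> (y \<oplus>\<^bsub>?M\<^esub> z)"
    if "x \<in> carrier ?M" "y \<in> carrier ?M" "z \<in> carrier ?M" for x y z
    by (simp add: quotient_module_def add.assoc)
  show "x \<oplus>\<^bsub>?M\<^esub> y = y \<oplus>\<^bsub>?M\<^esub> x" if "x \<in> carrier ?M" "y \<in> carrier ?M" for x y
    by (simp add: quotient_module_def add.commute)
qed

lemma finsum_coset:
  assumes "finite S" "\<And>s. s \<in> S \<Longrightarrow> r s \<in> lie_span A"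
  shows "(\<Oplus>\<^bsub>quotient_module (lie_span A) (lie_span B)\<^esub>s\<in>S. r s +o lie_span B) = (\<Sum>s\<in>S. r s) +o lie_span B"
  using assms
proof (induction S rule: finite_induct)
  case empty
  interpret abelian_monoid "quotient_module (lie_span A) (lie_span B)" by (rule abelian_monoid_quotient)
  show ?case by (simp only: finsum_empty sum.empty) (simp add: quotient_module_def)
next
  case (insert s S)
  let ?M = "quotient_module (lie_span A) (lie_span B)"
  interpret abelian_monoid ?M by (rule abelian_monoid_quotient)
  have "(\<Oplus>\<^bsub>?M\<^esub>s\<in>insert s S. r s +o lie_span B) =
      (r s +o lie_span B) \<oplus>\<^bsub>?M\<^esub> (\<Oplus>\<^bsub>?M\<^esub>s\<in>S. r s +o lie_span B)"
    using insert.prems by (intro finsum_insert insert.hyps) (auto simp: quotient_module_def)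
  also have "\<dots> = (r s +o lie_span B) \<oplus>\<^bsub>?M\<^esub> ((\<Sum>s\<in>S. r s) +o lie_span B)"
    using insert by simp
  also have "\<dots> = (r s + (\<Sum>s\<in>S. r s)) +o lie_span B"
    using coset_add by (simp add: quotient_module_def)
  finally show ?case using insert.hyps by simp
qed

text \<open>The cosets of the unit vectors at \<open>A - B\<close> form a basis: the coefficients of
  the coset of \<open>u\<close> are the entries of \<open>u\<close> there, which are the same for
  every representative.\<close>

lemma module_basis_quotient:
  assumes fin: "finite A"
  shows "\<exists>S. is_module_basis (quotient_module (lie_span A) (lie_span B)) S \<and> card S = card (A - B)"
proof -
  let ?W = "lie_span B" and ?M = "quotient_module (lie_span A) (lie_span B)"
  interpret abelian_monoid ?M by (rule abelian_monoid_quotient)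
  define e :: "partition \<times> nat \<Rightarrow> lie" where "e i = Poly_Mapping.single i 1" for i
  define h where "h i = e i +o ?W" for i
  define S where "S = h ` (A - B)"
  have e_lookup: "Poly_Mapping.lookup (e i) j = (if i = j then 1 else 0)" for i j
    by (simp add: e_def lookup_single when_def)
  have e_span: "e i \<in> lie_span A" if "i \<in> A - B" for i
    using that by (auto simp: lie_span_iff e_lookup)
  have inj: "inj_on h (A - B)"
  proof (rule inj_onI)
    fix i j assume i: "i \<in> A - B" and "h i = h j"
    then have "e i - e j \<in> lie_span B" by (simp only: h_def coset_eq_iff)
    then have "Poly_Mapping.lookup (e i - e j) i = 0" using i unfolding lie_span_iff by blast
    then show "i = j" by (simp add: lookup_minus e_lookup split: if_splits)
  qed
  have S_carrier: "S \<subseteq> carrier ?M"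
    using e_span by (auto simp: S_def h_def quotient_module_def)
  have smult: "c \<odot>\<^bsub>?M\<^esub> h i = lie_scale c (e i) +o ?W" for c i
    by (simp add: quotient_module_def h_def coset_scale)
  have comb: "(\<Oplus>\<^bsub>?M\<^esub>s\<in>S. c s \<odot>\<^bsub>?M\<^esub> s) = (\<Sum>i\<in>A - B. lie_scale (c (h i)) (e i)) +o ?W" for c
  proof -
    have "(\<Oplus>\<^bsub>?M\<^esub>s\<in>S. c s \<odot>\<^bsub>?M\<^esub> s) = (\<Oplus>\<^bsub>?M\<^esub>i\<in>A - B. c (h i) \<odot>\<^bsub>?M\<^esub> h i)"
      unfolding S_def
    proof (rule finsum_reindex[OF _ inj])
      show "(\<lambda>s. c s \<odot>\<^bsub>?M\<^esub> s) \<in> h ` (A - B) \<rightarrow> carrier ?M"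
        using e_span by (auto simp: smult) (auto simp: quotient_module_def intro!: imageI lie_span_scale)
    qed
    also have "\<dots> = (\<Sum>i\<in>A - B. lie_scale (c (h i)) (e i)) +o ?W"
      unfolding smult using fin e_span by (intro finsum_coset lie_span_scale) auto
    finally show ?thesis .
  qed
  have eq_iff: "u +o ?W = (\<Oplus>\<^bsub>?M\<^esub>s\<in>S. c s \<odot>\<^bsub>?M\<^esub> s) \<longleftrightarrow> (\<forall>i\<in>A - B. c (h i) = Poly_Mapping.lookup u i)"
    if u: "u \<in> lie_span A" for u c
  proof -
    have l: "Poly_Mapping.lookup (\<Sum>i\<in>A - B. lie_scale (c (h i)) (e i)) j = (if j \<in> A - B then c (h j) else 0)" for j
    proof -
      have "Poly_Mapping.lookup (\<Sum>i\<in>A - B. lie_scale (c (h i)) (e i)) j = (\<Sum>i\<in>A - B. if i = j then c (h j) else 0)"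
        unfolding lookup_sum by (intro sum.cong refl) (simp add: lookup_lie_scale e_lookup)
      then show ?thesis using fin by simp
    qed
    have u0: "Poly_Mapping.lookup u j = 0" if "j \<notin> A" for j using u that unfolding lie_span_iff by blast
    have "Poly_Mapping.lookup u j - (if j \<in> A - B then c (h j) else 0) = 0 \<longleftrightarrow>
        (j \<in> A - B \<longrightarrow> c (h j) = Poly_Mapping.lookup u j)" if "j \<notin> B" for j
      using u0[of j] that by (cases "j \<in> A") (auto simp: bit_add_eq_iff)
    then show ?thesis unfolding comb coset_eq_iff lie_span_iff lookup_minus l by blast
  qed
  have "\<exists>!c. c \<in> S \<rightarrow>\<^sub>E UNIV \<and> v = (\<Oplus>\<^bsub>?M\<^esub>s\<in>S. c s \<odot>\<^bsub>?M\<^esub> s)" if v: "v \<in> carrier ?M" for v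
  proof -
    obtain u where u: "u \<in> lie_span A" and v_eq: "v = u +o ?W" using v by (auto simp: quotient_module_def)
    \<comment> \<open>By \<open>inj\<close> each member of \<open>S\<close> comes from a single
      index, whose entry in \<open>u\<close> is its coefficient.\<close>
    let ?c = "\<lambda>s\<in>S. Poly_Mapping.lookup u (inv_into (A - B) h s)"
    show ?thesis
    proof (rule ex1I[of _ ?c])
      have "?c (h i) = Poly_Mapping.lookup u i" if "i \<in> A - B" for i
        using that inj by (simp add: S_def inv_into_f_f)
      then show "?c \<in> S \<rightarrow>\<^sub>E UNIV \<and> v = (\<Oplus>\<^bsub>?M\<^esub>s\<in>S. ?c s \<odot>\<^bsub>?M\<^esub> s)"
        unfolding v_eq eq_iff[OF u] by (auto simp: restrict_PiE_iff)
    next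
      fix c assume "c \<in> S \<rightarrow>\<^sub>E UNIV \<and> v = (\<Oplus>\<^bsub>?M\<^esub>s\<in>S. c s \<odot>\<^bsub>?M\<^esub> s)"
      then have c: "c \<in> S \<rightarrow>\<^sub>E UNIV" "\<And>i. i \<in> A - B \<Longrightarrow> c (h i) = Poly_Mapping.lookup u i"
        using eq_iff[OF u] unfolding v_eq by auto
      show "c = ?c"
      proof (rule PiE_ext[OF c(1)])
        show "?c \<in> S \<rightarrow>\<^sub>E UNIV" by simp
        show "c s = ?c s" if s: "s \<in> S" for s
          using s c(2)[OF inv_into_into[of s h "A - B"]] by (simp add: S_def f_inv_into_f)
      qed
    qed
  qed
  then have "is_module_basis ?M S"
    using S_carrier fin by (simp add: is_module_basis_def S_def)
  moreover have "card S = card (A - B)" unfolding S_def by (rule card_image[OF inj])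
  ultimately show ?thesis by blast
qed

text \<open>Coordinates with respect to \<open>S\<close> identify the carrier with the functions
  from \<open>S\<close> to \<open>bit\<close>. Hence all bases have the same size, which makes the
  description in \<open>module_rank\<close> unique.\<close>

lemma card_module_basis:
  assumes "is_module_basis (quotient_module (lie_span A) (lie_span B)) S"
  shows "card (carrier (quotient_module (lie_span A) (lie_span B))) = 2 ^ card S"
proof -
  let ?M = "quotient_module (lie_span A) (lie_span B)"
  interpret abelian_monoid ?M by (rule abelian_monoid_quotient)
  have S: "finite S" "S \<subseteq> carrier ?M"
    and uniq: "\<And>v. v \<in> carrier ?M \<Longrightarrow> \<exists>!c. c \<in> S \<rightarrow>\<^sub>E UNIV \<and> v = (\<Oplus>\<^bsub>?M\<^esub>s\<in>S. c s \<odot>\<^bsub>?M\<^esub> s)"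
    using assms unfolding is_module_basis_def by blast+
  let ?F = "\<lambda>c. \<Oplus>\<^bsub>?M\<^esub>s\<in>S. c s \<odot>\<^bsub>?M\<^esub> s"
  have closed: "?F c \<in> carrier ?M" for c
  proof (rule finsum_closed, rule Pi_I)
    fix s assume "s \<in> S"
    then obtain u where "u \<in> lie_span A" "s = u +o lie_span B" using S by (auto simp: quotient_module_def)
    then show "c s \<odot>\<^bsub>?M\<^esub> s \<in> carrier ?M"
      by (simp add: quotient_module_def coset_scale lie_span_scale)
  qed
  have "bij_betw ?F (S \<rightarrow>\<^sub>E UNIV) (carrier ?M)"
  proof (rule bij_betwI')
    show "?F c = ?F d \<longleftrightarrow> c = d" if cd: "c \<in> S \<rightarrow>\<^sub>E UNIV" "d \<in> S \<rightarrow>\<^sub>E UNIV" for c d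
    proof
      assume "?F c = ?F d"
      from uniq[OF closed[of c]] show "c = d"
        by (rule ex1E) (use cd \<open>?F c = ?F d\<close> in blast)
    qed simp
    show "?F c \<in> carrier ?M" for c by (rule closed)
    show "\<exists>c\<in>S \<rightarrow>\<^sub>E UNIV. v = ?F c" if "v \<in> carrier ?M" for v using uniq[OF that] by blast
  qed
  then have "card (carrier ?M) = card (S \<rightarrow>\<^sub>E (UNIV :: bit set))" by (simp add: bij_betw_same_card)
  then show ?thesis using S(1) by (simp add: card_PiE card_bit)
qed

lemma module_rank_quotient:
  assumes "finite A"
  shows "module_rank (quotient_module (lie_span A) (lie_span B)) = card (A - B)"
  unfolding module_rank_def
proof (rule the_equality)
  show ex: "\<exists>S. is_module_basis (quotient_module (lie_span A) (lie_span B)) S \<and> card S = card (A - B)"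
    by (rule module_basis_quotient[OF assms])
  fix r assume "\<exists>S. is_module_basis (quotient_module (lie_span A) (lie_span B)) S \<and> card S = r"
  then show "r = card (A - B)" using ex card_module_basis by (metis power_inject_exp one_less_numeral_iff semiring_norm(76))
qed

text \<open>Lagrange's theorem turns the index into a quotient of orders, which
  \<open>card_unitri\<close> and \<open>card_index_of\<close> express by the index sets.\<close>

lemma group_index_unitri:
  assumes H: "triangular n H" "substitution_closed n H" and H': "triangular n H'" "substitution_closed n H'"
    and sub: "\<And>k. k \<in> {1..n} \<Longrightarrow> H k \<subseteq> H' k"
  shows "group_index (Sylow2 n) (unitri n H') (unitri n H) = 2 ^ card (index_of n H' - index_of n H)"
proof -
  let ?K = "(Sylow2 n)\<lparr>carrier := unitri n H'\<rparr>"
  have "group ?K" by (rule group.subgroup_imp_group[OF group_Sylow2 subgroup_unitri[OF H']])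
  moreover have "subgroup (unitri n H) ?K"
    by (rule group.subgroup_incl[OF group_Sylow2 subgroup_unitri[OF H] subgroup_unitri[OF H'] unitri_mono[OF sub]])
  ultimately have "card (rcosets\<^bsub>?K\<^esub> (unitri n H)) * card (unitri n H) = order ?K"
    by (rule group.lagrange)
  then have "group_index (Sylow2 n) (unitri n H') (unitri n H) * 2 ^ card (index_of n H) = 2 ^ card (index_of n H')"
    by (simp add: group_index_def order_def card_unitri card_index_of H(1) H'(1))
  moreover have "card (index_of n H') = card (index_of n H' - index_of n H) + card (index_of n H)"
  proof -
    have "index_of n H \<subseteq> index_of n H'" by (rule index_of_mono[OF sub])
    then show ?thesis
      using finite_index_of[OF H(1)] finite_index_of[OF H'(1)] card_mono[of "index_of n H'" "index_of n H"]
      by (simp add: card_Diff_subset)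
  qed
  ultimately show ?thesis by (simp add: power_add)
qed

theorem theorem3p4:
  fixes n :: nat
  assumes "n \<ge> 3"
  shows "(\<forall>i. saturated n (to_rigid n ` basis_chain n i)
            \<and> saturated_subgroup n (normalizer_chain n i)
            \<and> normalizer_chain n i = generate (Sylow2 n) (to_rigid n ` basis_chain n i))
       \<and> (\<forall>i\<ge>1. real (module_rank (quotient_module (idealizer_chain n i) (idealizer_chain n (i - 1))))
            = log 2 (real (group_index (Sylow2 n) (normalizer_chain n i) (normalizer_chain n (i - 1)))))"
proof (intro conjI allI impI)
  fix i
  interpret F: admissible_family n "chain_family n i" by (rule admissible_chain)
  have eq: "to_rigid n ` basis_chain n i = gens n (chain_family n i)"
    by (simp add: basis_chain_eq to_rigid_basis_of F.tri)
  show sat: "saturated n (to_rigid n ` basis_chain n i)"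
    unfolding eq by (rule saturated_gens[OF F.tri F.subst])
  show gen: "normalizer_chain n i = generate (Sylow2 n) (to_rigid n ` basis_chain n i)"
    unfolding eq normalizer_chain_eq by (rule unitri_eq_generate_Sylow2[OF F.tri F.subst])
  have "subgroup (normalizer_chain n i) (Sylow2 n)"
    unfolding normalizer_chain_eq by (rule subgroup_unitri[OF F.tri F.subst])
  then show "saturated_subgroup n (normalizer_chain n i)"
    unfolding saturated_subgroup_def using sat gen by blast
next
  fix i :: nat assume "1 \<le> i"
  then obtain m where i: "i = Suc m" by (metis Suc_le_D One_nat_def)
  interpret F: admissible_family n "chain_family n m" by (rule admissible_chain)
  interpret F': admissible_family n "chain_family n (Suc m)" by (rule admissible_chain)
  \<comment> \<open>The number of basis indices that are new at this step of the chain: the rank is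
    \<open>?d\<close> and the group index is \<open>2 ^ ?d\<close>.\<close>
  let ?d = "card (index_of n (chain_family n (Suc m)) - index_of n (chain_family n m))"
  have "module_rank (quotient_module (idealizer_chain n i) (idealizer_chain n (i - 1))) = ?d"
    unfolding i idealizer_chain_eq by (simp only: diff_Suc_1) (rule module_rank_quotient[OF finite_index_of[OF F'.tri]])
  moreover have "group_index (Sylow2 n) (normalizer_chain n i) (normalizer_chain n (i - 1)) = 2 ^ ?d"
    unfolding i normalizer_chain_eq
    by (simp only: diff_Suc_1)
      (rule group_index_unitri[OF F.tri F.subst F'.tri F'.subst], simp add: F.family_subset_norm)
  ultimately show "real (module_rank (quotient_module (idealizer_chain n i) (idealizer_chain n (i - 1))))
      = log 2 (real (group_index (Sylow2 n) (normalizer_chain n i) (normalizer_chain n (i - 1))))"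
    by simp
qed

end
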